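(* There is a constant $C>0$ such that for every integer $n\ge 2$ there exist a polynomial $p$ of degree $n$ and a polynomial $q$ of degree $n-1$, all of whose coefficients have modulus $1$, such that the harmonic polynomial $H(z)=p(z)+\overline{q(z)}$ has at least $\frac{2}{\pi}n\log n - Cn$ zeros in $\mathbb{C}$.
   Context: A zero of $H$ is a point $z\in\mathbb{C}$ with $H(z)=0$. $\log$ is the natural logarithm. *)

theory Defs
  imports "HOL-Analysis.Analysis" "HOL-Computational_Algebra.Polynomial"
begin

definition unimodular_coeffs :: "complex poly \<Rightarrow> bool" where
  "unimodular_coeffs p \<longleftrightarrow> (\<forall>i\<le>degree p. norm (coeff p i) = 1)"

end

theory Submission
  imports Defs "HOL-Real_Asymp.Real_Asymp"
begin

text \<open>
  Take \<open>q = e\<^bsup>i\<pi>/3\<^esup> \<Sum>\<^bsub>k<n\<^esub> A\<^sub>k z\<^sup>k\<close> and \<open>p = z\<^sup>n + q\<close>, where \<open>A\<^sub>0, \<dots>, A\<^sub>n\<close> is palindromic with \<open>A\<^sub>0 = 1\<close>.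
  On the \<open>2n\<close> rays where \<open>z\<^sup>n\<close> is real, \<open>H\<close> is real and equals twice the real part of
  \<open>e\<^bsup>i\<pi>/3\<^esup> G(z)\<close> with \<open>G(z) = \<Sum>\<^bsub>k\<le>n\<^esub> A\<^sub>k z\<^sup>k\<close>; the choice of \<open>\<pi>/3\<close> absorbs the leading term. The zeros on
  these rays are invariant under \<open>z \<mapsto> 1/z\<close>, so it suffices to count those in the unit disc.

  The first \<open>2\<^sup>L\<close> coefficients of \<open>G\<close> are those of \<open>(1 - cz) \<Prod>\<^bsub>1\<le>m<L\<^esub> (1 - z\<^bsup>2^m\<^esup>)\<close>, a Thue-Morse product
  with one free unimodular parameter \<open>c\<close>. Its argument is a sum of principal arguments. Near the
  unit circle the factor \<open>1 - cz\<close> only shifts the argument by an angle that is equidistributed mod \<open>\<pi>\<close>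
  when \<open>c\<close> runs through the roots of unity of a fixed order, so on average over \<open>c\<close> the number of zeros on a
  piece of a ray is \<open>1/\<pi>\<close> times the change of the argument of the product. Testing this change
  between the radii \<open>(7/10)\<^bsup>1/2^i\<^esup>\<close> and \<open>(7/10)\<^bsup>1/2^(i+1)\<^esup>\<close> against a trigonometric polynomial in \<open>2\<^bsup>i+1\<^esup>\<theta>\<close>
  that is bounded by 1 shows that its mean modulus over the rays is at least 0.361. Since this exceeds
  \<open>(ln 2)/2\<close>, summing over almost \<open>log\<^sub>2 n\<close> values of \<open>i\<close> gives more than \<open>(2/\<pi>) n ln n\<close> zeros.
\<close>

section \<open>Integer values of continuous functions\<close>

text \<open>Hermite's identity. With \<open>k\<close> the floor of \<open>Q * x\<close>, the terms
  are \<open>(k + l) div Q\<close>; passing from \<open>m\<close> to \<open>m + 1\<close> trades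
  \<open>m div Q\<close> for \<open>(m + Q) div Q\<close>, so the sum grows by exactly 1.\<close>

lemma sum_floor_shift:
  fixes x :: real
  assumes "Q > 0"
  shows "(\<Sum>l<Q. \<lfloor>x + real l / real Q\<rfloor>) = \<lfloor>real Q * x\<rfloor>"
proof -
  define k where "k = \<lfloor>real Q * x\<rfloor>"
  have step: "(\<Sum>l<Q. (m + 1 + int l) div int Q) = (\<Sum>l<Q. (m + int l) div int Q) + 1" for m :: int
  proof -
    have "(\<Sum>l<Q. (m + 1 + int l) div int Q) = (\<Sum>l<Q. (m + int (Suc l)) div int Q)"
      by (simp add: algebra_simps)
    also have "\<dots> = (\<Sum>l<Suc Q. (m + int l) div int Q) - m div int Q"
      by (subst sum.lessThan_Suc_shift) simp
    also have "\<dots> = (\<Sum>l<Q. (m + int l) div int Q) + 1"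
      using assms by simp
    finally show ?thesis .
  qed
  have "(\<Sum>l<Q. (m + int l) div int Q) = m" for m :: int
  proof (induction m rule: int_induct[where k = 0])
    case base
    then show ?case by simp
  next
    case (step1 i)
    then show ?case using step[of i] by simp
  next
    case (step2 i)
    then show ?case using step[of "i - 1"] by simp
  qed
  moreover have "\<lfloor>x + real l / real Q\<rfloor> = (k + int l) div int Q" for l
  proof -
    have "x + real l / real Q = (real Q * x + real l) / real_of_int (int Q)"
      using assms by (simp add: field_simps)
    also have "\<lfloor>\<dots>\<rfloor> = \<lfloor>real Q * x + real l\<rfloor> div int Q"
      using assms by (intro floor_divide_real_eq_div) auto
    also have "\<lfloor>real Q * x + real l\<rfloor> = k + int l"
      unfolding k_def by linarith
    finally show ?thesis .
  qed
  ultimately show ?thesis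
    by (simp add: k_def)
qed

text \<open>The intermediate value theorem applies to every integer above \<open>V\<close> and at
  most \<open>U\<close>. The strict inequalities at the ends keep the points off \<open>a\<close>
  and \<open>b\<close>, so that adjacent intervals later give disjoint sets.\<close>

lemma integer_values_between:
  fixes f :: "real \<Rightarrow> real"
  assumes "a < b" and cont: "continuous_on {a..b} f"
    and ends: "f a < V \<and> U < f b \<or> f b < V \<and> U < f a"
  shows "\<exists>R. finite R \<and> R \<subseteq> {a<..<b} \<and> (\<forall>r\<in>R. f r \<in> \<int>) \<and> \<lfloor>U\<rfloor> - \<lfloor>V\<rfloor> \<le> int (card R)"
proof -
  define M where "M = {\<lfloor>V\<rfloor><..\<lfloor>U\<rfloor>}"
  have "\<exists>r\<in>{a<..<b}. f r = of_int m" if "m \<in> M" for m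
  proof -
    have m: "V < of_int m" "of_int m \<le> U"
      using that unfolding M_def by (auto simp: le_floor_iff floor_less_iff)
    have "\<exists>r. a \<le> r \<and> r \<le> b \<and> f r = of_int m"
      using ends
    proof
      assume "f a < V \<and> U < f b"
      then show ?thesis using IVT'[of f a "of_int m" b] m assms by auto
    next
      assume "f b < V \<and> U < f a"
      then show ?thesis using IVT2'[of f b "of_int m" a] m assms by auto
    qed
    then obtain r where "a \<le> r" "r \<le> b" "f r = of_int m" by blast
    moreover have "r \<noteq> a" "r \<noteq> b" using ends m \<open>f r = of_int m\<close> by auto
    ultimately show ?thesis by force
  qed
  then obtain g where g: "\<And>m. m \<in> M \<Longrightarrow> g m \<in> {a<..<b} \<and> f (g m) = of_int m"
    by metis
  have "inj_on g M"
    by (rule inj_onI) (metis g of_int_eq_iff)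
  then have "card (g ` M) = nat (\<lfloor>U\<rfloor> - \<lfloor>V\<rfloor>)"
    by (simp add: card_image M_def)
  then show ?thesis
    using g by (intro exI[of _ "g ` M"]) (auto simp: M_def)
qed

section \<open>Thue-Morse products\<close>

text \<open>Multiplication by \<open>1 - z^(2^L)\<close> appends the negated block of coefficients,
  so all of them stay unimodular. The factor with parameter \<open>c\<close> takes the place of the
  one with \<open>m = 0\<close>.\<close>

lemma thue_morse_type_coeffs:
  fixes c :: complex
  assumes "norm c = 1" and "L \<ge> 1"
  shows "\<exists>a::nat \<Rightarrow> complex. (\<forall>k. norm (a k) = 1) \<and> a 0 = 1 \<and>
           (\<forall>z. (\<Sum>k<2^L. a k * z^k) = (1 - c * z) * (\<Prod>m=1..<L. 1 - z^(2^m)))"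
  using assms(2)
proof (induction L rule: dec_induct)
  case base
  show ?case
    using assms(1) by (intro exI[of _ "\<lambda>k. if k = 0 then 1 else - c"]) (simp add: numeral_2_eq_2)
next
  case (step L)
  then obtain a :: "nat \<Rightarrow> complex" where a: "\<And>k. norm (a k) = 1" "a 0 = 1"
    "\<And>z. (\<Sum>k<2^L. a k * z^k) = (1 - c * z) * (\<Prod>m=1..<L. 1 - z^(2^m))"
    by blast
  define a' where "a' k = (if k < 2^L then a k else - a (k - 2^L))" for k
  have "(\<Sum>k<2^Suc L. a' k * z^k) = (1 - c * z) * (\<Prod>m=1..<Suc L. 1 - z^(2^m))" for z
  proof -
    have split: "{..<2 ^ Suc L} = {..<2^L} \<union> {2^L..<2^L + (2::nat)^L}"
      by auto
    have "(\<Sum>k<2^Suc L. a' k * z^k) = (\<Sum>k<2^L. a' k * z^k) + (\<Sum>k=2^L..<2^L + 2^L. a' k * z^k)"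
      unfolding split by (rule sum.union_disjoint) auto
    also have "(\<Sum>k=2^L..<2^L + 2^L. a' k * z^k) = (\<Sum>k<2^L. a' (k + 2^L) * z^(k + 2^L))"
      using sum.shift_bounds_nat_ivl[of "\<lambda>k. a' k * z^k" 0 "2^L" "2^L"]
      by (simp add: lessThan_atLeast0)
    also have "\<dots> = - (z^(2^L)) * (\<Sum>k<2^L. a k * z^k)"
      by (simp add: a'_def sum_distrib_left power_add mult_ac sum_negf)
    also have "(\<Sum>k<2^L. a' k * z^k) = (\<Sum>k<2^L. a k * z^k)"
      by (intro sum.cong) (auto simp: a'_def)
    finally show ?thesis
      using step.hyps by (simp add: a algebra_simps)
  qed
  then show ?case
    using a(1,2) by (intro exI[of _ a']) (auto simp: a'_def)
qed

section \<open>The test function and the radii\<close>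

text \<open>Numerically close to the sine polynomial of degree 4 and sup norm 1 that maximises the gain in
  \<open>test_fun_gain\<close>.\<close>

definition test_fun :: "real \<Rightarrow> real" where
  "test_fun y = 65/100 * sin y + 71/100 * sin (2 * y) - 33/100 * sin (3 * y) + 40/100 * sin (4 * y)"

text \<open>A sum-of-squares certificate: up to scaling, \<open>1 - test_fun y\<close> is a square
  modulus plus a remainder whose constant term 1160 exceeds 664, the sum of the moduli of its other
  coefficients.\<close>

lemma test_fun_le_1: "test_fun y \<le> 1"
proof -
  define C1 C2 C3 C4 where "C1 = cos y" and "C2 = cos (2 * y)" and "C3 = cos (3 * y)" and "C4 = cos (4 * y)"
  define S1 S2 S3 S4 where "S1 = sin y" and "S2 = sin (2 * y)" and "S3 = sin (3 * y)" and "S4 = sin (4 * y)"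
  note defs = C1_def C2_def C3_def C4_def S1_def S2_def S3_def S4_def
  have pyth: "C1*C1 + S1*S1 = 1" "C2*C2 + S2*S2 = 1" "C3*C3 + S3*S3 = 1" "C4*C4 + S4*S4 = 1"
    unfolding defs by (simp_all flip: power2_eq_square)
  have diffs: "C2*C1 + S2*S1 = C1" "C3*C2 + S3*S2 = C1" "C4*C3 + S4*S3 = C1"
    "C3*C1 + S3*S1 = C2" "C4*C2 + S4*S2 = C2" "C4*C1 + S4*S1 = C3"
    "S2*C1 - C2*S1 = S1" "S3*C2 - C3*S2 = S1" "S4*C3 - C4*S3 = S1"
    "S3*C1 - C3*S1 = S2" "S4*C2 - C4*S2 = S2" "S4*C1 - C4*S1 = S3"
    unfolding defs by (simp_all flip: cos_diff sin_diff)
  \<comment> \<open>\<open>A + iB\<close> is a rounded Fejer-Riesz factor of \<open>1 - test_fun\<close>, scaled by 400.\<close>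
  define A where "A = -68*C1 - 89*S1 - 21*C2 + 168*S2 - 15*C3 + 164*S3 + 278*C4"
  define B where "B = -115 - 68*S1 + 89*C1 - 21*S2 - 168*C2 - 15*S3 - 164*C3 + 278*S4"
  have "160000 * (1 - test_fun y) = A * A + B * B + 1160 + 124*C1 + 188*C2 + 88*C3
      - 22*S1 - 48*S2 - 134*S3 - 60*S4"
    using pyth diffs unfolding test_fun_def A_def B_def
    unfolding defs[symmetric] by (simp add: algebra_simps)
  moreover have "C1 \<ge> -1" "C2 \<ge> -1" "C3 \<ge> -1" "S1 \<le> 1" "S2 \<le> 1" "S3 \<le> 1" "S4 \<le> 1"
    unfolding defs by simp_all
  moreover have "A * A + B * B \<ge> 0"
    by simp
  ultimately have "160000 * (1 - test_fun y) \<ge> 0"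
    by linarith
  then show ?thesis
    by simp
qed

lemma abs_test_fun_le_1: "\<bar>test_fun y\<bar> \<le> 1"
proof -
  have "test_fun (- y) = - test_fun y"
    by (simp add: test_fun_def)
  then show ?thesis
    using test_fun_le_1[of y] test_fun_le_1[of "- y"] by linarith
qed

text \<open>Iterated square roots of 7/10: \<open>rad i ^ (2^i)\<close> is 7/10 at every scale, so
  at frequencies that are multiples of \<open>2 ^ Suc i\<close> the radii \<open>rad i\<close> and
  \<open>rad (Suc i)\<close> enter only through powers of 7/10, independently of
  \<open>i\<close>.\<close>

definition rad :: "nat \<Rightarrow> real" where
  "rad i = (7/10) powr (1 / 2^i)"

lemma rad_pos: "rad i > 0" and rad_less_1: "rad i < 1"
  using powr_less_mono2[of "1 / 2^i" "7/10" 1] by (simp_all add: rad_def)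

lemma rad_power: "rad i ^ (2 ^ i * k) = (7/10) ^ k"
proof -
  have "rad i ^ (2 ^ i) = 7/10"
    by (simp add: rad_def flip: powr_realpow) (simp add: powr_powr)
  then show ?thesis
    by (simp only: power_mult)
qed

lemma rad_strict_mono: "i < j \<Longrightarrow> rad i < rad j"
  unfolding rad_def by (intro powr_less_mono') (auto simp: field_simps)

lemma rad_mono: "i \<le> j \<Longrightarrow> rad i \<le> rad j"
  using rad_strict_mono[of i j] by (cases "i = j") auto

text \<open>Bernoulli's inequality at \<open>rad i\<close> gives
  \<open>2^i * (1 - rad i) \<ge> 3/10\<close>, which is more than 1/4.\<close>

lemma one_minus_rad_ge: "1 - rad i \<ge> 1 / 2 ^ (i + 2)"
proof -
  have "1 + real (2^i) * (rad i - 1) \<le> rad i ^ (2^i)"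
    using Bernoulli_inequality[of "rad i - 1" "2^i"] rad_pos[of i] by simp
  then have "2^i * (1 - rad i) \<ge> 3/10"
    using rad_power[of i 1] by (simp add: algebra_simps)
  then show ?thesis
    by (simp add: field_simps)
qed

text \<open>Bernoulli's inequality at \<open>1 / rad i\<close>, whose power with exponent
  \<open>2^i\<close> is 10/7, combined with \<open>1 - r \<le> 1 / r - 1\<close>.\<close>

lemma one_minus_rad_le: "1 - rad i \<le> 1 / 2 ^ i"
proof -
  have "1 + real (2^i) * (1 / rad i - 1) \<le> (1 / rad i) ^ (2^i)"
    using Bernoulli_inequality[of "1 / rad i - 1" "2^i"] rad_pos[of i] by simp
  also have "\<dots> = 1 / (7/10)"
    using rad_power[of i 1] by (simp only: power_one_over mult_1_right power_one_right)
  also have "\<dots> \<le> 2"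
    by simp
  finally have "2^i * (1 / rad i - 1) \<le> 1"
    by simp
  moreover have "1 - rad i \<le> 1 / rad i - 1"
  proof -
    have "1 / rad i - 1 - (1 - rad i) = (1 - rad i)\<^sup>2 / rad i"
      using rad_pos[of i] by (simp add: field_simps power2_eq_square)
    also have "\<dots> \<ge> 0"
      using rad_pos[of i] by simp
    finally show ?thesis by simp
  qed
  then have "2^i * (1 - rad i) \<le> 2^i * (1 / rad i - 1)"
    by (rule mult_left_mono) simp
  ultimately have "2^i * (1 - rad i) \<le> 1"
    by (rule order.trans[rotated])
  then show ?thesis
    by (simp add: field_simps)
qed

text \<open>Stopping \<open>L div 40\<close> octaves before \<open>L\<close> makes
  \<open>r ^ (2^L)\<close> doubly exponentially small in \<open>L\<close>, while
  \<open>1 - r\<close> is at least \<open>1 / 2 ^ (L + 2)\<close>. This is what makes the truncation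
  errors harmless later.\<close>

lemma rad_tail_negligible:
  assumes "\<mu> > 0"
  shows "\<forall>\<^sub>F L in sequentially. \<forall>r. 0 \<le> r \<and> r \<le> rad (L - L div 40) \<longrightarrow>
           real L * r ^ (2^L) \<le> \<mu> * (1 - r) ^ (L + 1)"
proof -
  have "(\<lambda>L::nat. real L * (7/10) powr (2 powr (real L / 40 - 1)) * 2 powr ((real L + 2) * (real L + 1))) \<longlonglongrightarrow> 0"
    by real_asymp
  then have "\<forall>\<^sub>F L in sequentially. real L * (7/10) powr (2 powr (real L / 40 - 1)) * 2 powr ((real L + 2) * (real L + 1)) < \<mu>"
    using assms by (rule order_tendstoD)
  then show ?thesis
  proof eventually_elim
    case (elim L)
    show ?case
    proof (intro allI impI)
      fix r assume r: "0 \<le> r \<and> r \<le> rad (L - L div 40)"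
      define i where "i = L - L div 40"
      have "(2::nat)^L = 2^i * 2^(L div 40)"
        unfolding i_def by (simp flip: power_add)
      then have "rad i ^ (2^L) = (7/10) ^ (2 ^ (L div 40))"
        by (simp only: rad_power)
      then have "r ^ (2^L) \<le> (7/10) ^ (2 ^ (L div 40))"
        using power_mono[of r "rad i" "2^L"] r unfolding i_def by metis
      also have "\<dots> = (7/10) powr (2 powr (L div 40))"
        using powr_realpow[of "7/10::real" "2 ^ (L div 40)"] by (simp add: powr_realpow)
      also have "\<dots> \<le> (7/10) powr (2 powr (real L / 40 - 1))"
      proof (rule powr_mono')
        have "real L / 40 - 1 \<le> real (L div 40)" by linarith
        then show "2 powr (real L / 40 - 1) \<le> 2 powr real (L div 40)" by simp
      qed auto
      finally have "real L * r ^ (2^L) \<le> real L * (7/10) powr (2 powr (real L / 40 - 1))"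
        by (rule mult_left_mono) simp
      also have "\<dots> \<le> \<mu> * (1 / 2 powr ((real L + 2) * (real L + 1)))"
        using elim by (simp add: field_simps)
      also have "\<dots> = \<mu> * (1 / 2 ^ (L + 2)) ^ (L + 1)"
      proof -
        have "2 powr ((real L + 2) * (real L + 1)) = 2 powr real ((L + 2) * (L + 1))"
          by (simp add: algebra_simps)
        also have "\<dots> = (2 ^ (L + 2)) ^ (L + 1)"
          by (subst powr_realpow) (simp_all only: power_mult zero_less_numeral)
        finally show ?thesis
          by (simp only: power_one_over)
      qed
      also have "\<dots> \<le> \<mu> * (1 - r) ^ (L + 1)"
      proof (intro mult_left_mono power_mono)
        have "1 / 2 ^ (L + 2) \<le> (1::real) / 2 ^ (i + 2)"
          by (intro divide_left_mono power_increasing) (auto simp: i_def)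
        then show "1 / 2 ^ (L + 2) \<le> 1 - r"
          using one_minus_rad_ge[of i] r unfolding i_def by linarith
      qed (use assms in auto)
      finally show "real L * r ^ (2^L) \<le> \<mu> * (1 - r) ^ (L + 1)" .
    qed
  qed
qed

section \<open>Fourier analysis on the rays\<close>

text \<open>Imaginary part of the power series of \<open>- Ln (1 - w)\<close>; its summand at
  \<open>k = 0\<close> is 0.\<close>

lemma Im_Ln_one_minus_sums:
  assumes "norm w < 1"
  shows "(\<lambda>k. Im (w ^ k) / real k) sums (- Im (Ln (1 - w)))"
proof -
  have "(\<lambda>k. - ((- (- w)) ^ k) / of_nat k) sums Ln (1 + (- w))"
    using assms by (intro Ln_series') simp
  then have "(\<lambda>k. - Im (- (w ^ k) / of_nat k)) sums (- Im (Ln (1 - w)))"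
    by (intro sums_minus sums_Im) simp
  then show ?thesis
    by simp
qed

text \<open>A geometric sum over powers of a \<open>2*n\<close>-th root of unity, which is 1 exactly
  if \<open>2*n\<close> divides \<open>D\<close>. The grid consists of the angles at which
  \<open>z ^ n\<close> is real.\<close>

lemma sum_cos_grid:
  fixes D :: int
  assumes "n > 0"
  shows "(\<Sum>j<2*n. cos (of_int D * (pi * real j / real n))) = (if int (2*n) dvd D then 2 * real n else 0)"
proof -
  define x where "x = cis (of_int D * pi / real n)"
  have "(\<Sum>j<2*n. cos (of_int D * (pi * real j / real n))) = Re (\<Sum>j<2*n. x ^ j)"
    unfolding x_def Re_sum by (intro sum.cong refl) (simp add: Complex.DeMoivre mult_ac)
  also have "(\<Sum>j<2*n. x ^ j) = (if int (2*n) dvd D then 2 * of_nat n else 0)"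
  proof (cases "int (2*n) dvd D")
    case True
    then obtain k where "D = int (2*n) * k" by blast
    then have "of_int D * pi / real n = 2 * pi * of_int k"
      using assms by (simp add: field_simps)
    then have "x = 1"
      unfolding x_def by (simp add: complex_eq_iff)
    then show ?thesis using True by simp
  next
    case False
    have "x \<noteq> 1"
    proof
      assume "x = 1"
      then have "cos (of_int D * pi / real n) = 1"
        by (simp add: x_def complex_eq_iff)
      then obtain k :: int where "of_int D * pi / real n = of_int k * 2 * pi"
        using cos_one_2pi_int by blast
      then have "of_int D = (of_int (k * (2 * int n)) :: real)"
        using assms by (simp add: field_simps)
      then have "D = k * (2 * int n)"
        by (simp only: of_int_eq_iff)
      then show False using False by simp
    qed
    moreover have "x ^ (2*n) = 1"
    proof -
      have "real (2*n) * (of_int D * pi / real n) = 2 * pi * of_int D"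
        using assms by (simp add: field_simps)
      then show ?thesis
        unfolding x_def Complex.DeMoivre by (simp add: complex_eq_iff)
    qed
    ultimately show ?thesis
      using False by (simp add: geometric_sum)
  qed
  finally show ?thesis by simp
qed

lemma sum_sin_sin_grid:
  fixes N K :: nat
  assumes "n > 0"
  shows "(\<Sum>j<2*n. sin (real K * (pi * real j / real n)) * sin (real N * (pi * real j / real n))) =
    ((if int (2*n) dvd int K - int N then real n else 0) - (if int (2*n) dvd int K + int N then real n else 0))"
proof -
  have "sin (real K * t) * sin (real N * t) =
     (cos (of_int (int K - int N) * t) - cos (of_int (int K + int N) * t)) / 2" for t :: real
    by (simp add: sin_times_sin algebra_simps)
  then have "(\<Sum>j<2*n. sin (real K * (pi * real j / real n)) * sin (real N * (pi * real j / real n))) =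
    ((\<Sum>j<2*n. cos (of_int (int K - int N) * (pi * real j / real n)))
     - (\<Sum>j<2*n. cos (of_int (int K + int N) * (pi * real j / real n)))) / 2"
    by (simp only: sum_subtractf sum_divide_distrib diff_divide_distrib)
  also have "\<dots> = (if int (2*n) dvd int K - int N then real n else 0)
      - (if int (2*n) dvd int K + int N then real n else 0)"
    unfolding sum_cos_grid[OF assms] by simp
  finally show ?thesis .
qed

text \<open>Expand \<open>- Im (Ln (1 - z ^ (2^m)))\<close> into sines of frequency
  \<open>2^m * k\<close>. On the grid only frequencies congruent to \<open>K\<close> or
  \<open>- K\<close> modulo \<open>2*n\<close> survive: \<open>2^m * k = K\<close> gives the main
  term, and all others are at least \<open>n\<close>, hence carry a tiny power of
  \<open>r\<close>.\<close>

lemma sum_sin_Ln_grid: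
  fixes m n K :: nat and r :: real
  assumes "m \<ge> 1" "0 < K" "K < n" "0 \<le> r" "r < 1"
  shows "\<bar>(\<Sum>j<2*n. sin (real K * (pi * real j / real n)) *
             Im (Ln (1 - (of_real r * cis (pi * real j / real n)) ^ (2^m))))
          + (if 2^m dvd K then real n * r ^ K * 2^m / real K else 0)\<bar>
         \<le> 2 * real n * r ^ (n div 2) / (1 - r)"
proof -
  have "n > 0" using assms by simp
  define \<theta> where "\<theta> j = pi * real j / real n" for j
  define t where "t k = (\<Sum>j<2*n. sin (real K * \<theta> j) * (Im (((of_real r * cis (\<theta> j)) ^ (2^m)) ^ k) / real k))" for k
  define main where "main = (if 2^m dvd K then real n * r ^ K * 2^m / real K else 0)"
  have t_sums: "t sums (\<Sum>j<2*n. sin (real K * \<theta> j) * (- Im (Ln (1 - (of_real r * cis (\<theta> j)) ^ (2^m)))))"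
    unfolding t_def
    by (intro sums_sum sums_mult Im_Ln_one_minus_sums)
       (use assms in \<open>simp add: norm_power norm_mult power_less_one_iff\<close>)
  have t_eq: "t k = r ^ (2^m * k) / real k * ((if int (2*n) dvd int K - int (2^m * k) then real n else 0)
       - (if int (2*n) dvd int K + int (2^m * k) then real n else 0))" for k
  proof -
    have Im_cis: "Im (of_real a * cis b) = a * sin b" for a b :: real
      by simp
    have "((of_real r * cis (\<theta> j)) ^ (2^m)) ^ k = of_real (r ^ (2^m * k)) * cis (real (2^m * k) * \<theta> j)" for j
      unfolding power_mult[symmetric] unfolding power_mult_distrib Complex.DeMoivre of_real_power ..
    then have Im_eq: "Im (((of_real r * cis (\<theta> j)) ^ (2^m)) ^ k) = r ^ (2^m * k) * sin (real (2^m * k) * \<theta> j)" for j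
      by (simp only: Im_cis)
    have swap: "a * (b * c / d) = b / d * (a * c)" for a b c d :: real
      by simp
    have "t k = (\<Sum>j<2*n. r ^ (2^m * k) / real k * (sin (real K * \<theta> j) * sin (real (2^m * k) * \<theta> j)))"
      unfolding t_def Im_eq swap ..
    also have "\<dots> = r ^ (2^m * k) / real k * (\<Sum>j<2*n. sin (real K * \<theta> j) * sin (real (2^m * k) * \<theta> j))"
      by (rule sum_distrib_left[symmetric])
    finally show ?thesis
      unfolding \<theta>_def sum_sin_sin_grid[OF \<open>n > 0\<close>] .
  qed
  \<comment> \<open>If \<open>2^m\<close> does not divide \<open>K\<close>, then \<open>main\<close>
    is 0 and its position in the series is immaterial.\<close>
  have main_sums: "(\<lambda>k. if k = K div 2^m then main else 0) sums main"
    using sums_single[of "K div 2^m" "\<lambda>_. main"] by (simp add: eq_commute)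
  have bound: "norm (t k - (if k = K div 2^m then main else 0)) \<le> 2 * real n * r ^ (n div 2) * r ^ k" for k
  proof (cases "2^m * k = K")
    case True
    then have k: "k = K div 2^m" "k > 0" "2^m dvd K"
      using assms by auto
    have "\<not> int (2*n) dvd int K + int (2^m * k)"
      unfolding True using assms zdvd_imp_le[of "int (2*n)" "int K + int K"] by auto
    then have "t k = r ^ K / real k * real n"
      unfolding t_eq True by simp
    also have "\<dots> = main"
      using k True by (auto simp: main_def field_simps)
    finally show ?thesis
      using k assms by simp
  next
    case False
    have z: "(if k = K div 2^m then main else 0) = 0"
      using False by (auto simp: main_def)
    show ?thesis
    proof (cases "k = 0 \<or> 2^m * k < n")
      case True
      have "t k = 0"
      proof (cases "k = 0")
        case False
        then have *: "2^m * k < n" "2^m * k > 0" using True by auto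
        have "\<not> int (2*n) dvd int K - int (2^m * k)"
        proof
          assume "int (2*n) dvd int K - int (2^m * k)"
          moreover have "int K \<noteq> int (2^m * k)"
            using \<open>2^m * k \<noteq> K\<close> by (metis of_nat_eq_iff)
          ultimately have "int (2*n) \<le> \<bar>int K - int (2^m * k)\<bar>"
            by (intro zdvd_imp_le) (simp_all del: of_nat_mult of_nat_power)
          then show False using * assms by linarith
        qed
        moreover have "\<not> int (2*n) dvd int K + int (2^m * k)"
        proof
          assume "int (2*n) dvd int K + int (2^m * k)"
          then have "int (2*n) \<le> int K + int (2^m * k)"
            by (intro zdvd_imp_le) (use assms in linarith)+
          then show False using * assms by linarith
        qed
        ultimately show ?thesis by (simp add: t_eq)
      qed (simp add: t_eq)
      then show ?thesis using z assms by simp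
    next
      case False
      then have *: "k > 0" "n \<le> 2^m * k" by auto
      \<comment> \<open>Averaging \<open>2 * k \<le> 2^m * k\<close> with
        \<open>n \<le> 2^m * k\<close> leaves a factor \<open>r ^ k\<close>, so the error is
        summable as a geometric series.\<close>
      have "2 * k \<le> 2^m * k"
        using assms(1) power_increasing[of 1 m "2::nat"] by simp
      then have "n div 2 + k \<le> 2^m * k"
        using * by linarith
      then have rp: "r ^ (2^m * k) \<le> r ^ (n div 2) * r ^ k"
        using assms by (simp add: power_decreasing flip: power_add)
      have "\<bar>t k\<bar> \<le> r ^ (2^m * k) / real k * (2 * real n)"
        unfolding t_eq abs_mult using assms by (intro mult_mono) auto
      also have "\<dots> \<le> r ^ (2^m * k) / 1 * (2 * real n)"
        using * assms by (intro mult_right_mono divide_left_mono) auto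
      also have "\<dots> \<le> (r ^ (n div 2) * r ^ k) * (2 * real n)"
        using rp by (intro mult_right_mono) auto
      finally show ?thesis
        using z by (simp add: mult_ac)
    qed
  qed
  have "norm ((\<Sum>j<2*n. sin (real K * \<theta> j) * (- Im (Ln (1 - (of_real r * cis (\<theta> j)) ^ (2^m))))) - main)
      \<le> 2 * real n * r ^ (n div 2) * (1 / (1 - r))"
    by (rule norm_sums_le[OF sums_diff[OF t_sums main_sums] sums_mult[OF geometric_sums] bound])
       (use assms in auto)
  then show ?thesis
    unfolding main_def \<theta>_def by (simp add: sum_negf abs_minus_commute algebra_simps)
qed

section \<open>The argument of the Thue-Morse product along the rays\<close>

text \<open>Every factor has positive real part in the unit disc, so this sum of principal arguments
  is a continuous branch of the argument of the product; it need not be the principal one.\<close>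

definition tm_arg :: "nat \<Rightarrow> complex \<Rightarrow> real" where
  "tm_arg L z = (\<Sum>m=1..<L. Im (Ln (1 - z ^ (2^m))))"

text \<open>For odd \<open>d\<close>, the factors that contribute at frequency
  \<open>2^t * d\<close> are those with \<open>1 \<le> m \<le> t\<close>; their weights
  \<open>2^m\<close> add up to \<open>2 ^ (t + 1) - 2\<close>.\<close>

lemma sum_sin_tm_arg_grid:
  fixes n K t L :: nat and r :: real
  assumes "odd d" "K = 2^t * d" "t < L" "K < n" "0 \<le> r" "r < 1"
  shows "\<bar>(\<Sum>j<2*n. sin (real K * (pi * real j / real n)) * tm_arg L (of_real r * cis (pi * real j / real n)))
          + real n * r ^ K * (2 ^ (t + 1) - 2) / real K\<bar>
         \<le> real L * (2 * real n * r ^ (n div 2) / (1 - r))"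
proof -
  have "K > 0" using assms(1,2) by (auto intro!: Nat.gr0I)
  define \<theta> where "\<theta> j = pi * real j / real n" for j
  define s where "s m = (\<Sum>j<2*n. sin (real K * \<theta> j) * Im (Ln (1 - (of_real r * cis (\<theta> j)) ^ (2^m))))" for m
  define main where "main m = (if 2^m dvd K then real n * r ^ K * 2^m / real K else 0)" for m
  have dvd_iff: "2^m dvd K \<longleftrightarrow> m \<le> t" for m
  proof
    assume "2^m dvd K"
    show "m \<le> t"
    proof (rule ccontr)
      assume "\<not> m \<le> t"
      then have "2 ^ (t + 1) dvd (2::nat) ^ m" by (intro le_imp_power_dvd) simp
      then have "2 ^ (t + 1) dvd 2^t * d" using \<open>2^m dvd K\<close> assms(2) dvd_trans by blast
      then show False using assms(1) by simp
    qed
  next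
    assume "m \<le> t"
    then show "2^m dvd K"
      unfolding assms(2) by (intro dvd_mult2 le_imp_power_dvd)
  qed
  have "(\<Sum>m=1..<L. main m) = (\<Sum>m=1..t. real n * r ^ K * 2^m / real K)"
    unfolding main_def dvd_iff using assms(3)
    by (intro sum.mono_neutral_cong_right) auto
  also have "\<dots> = real n * r ^ K / real K * (\<Sum>m=1..t. 2^m)"
    by (simp add: sum_distrib_left)
  also have "(\<Sum>m=1..t. 2^m) = (2 ^ (t + 1) - 2 :: real)"
    by (induction t) auto
  finally have main: "(\<Sum>m=1..<L. main m) = real n * r ^ K * (2 ^ (t + 1) - 2) / real K"
    by simp
  have "(\<Sum>j<2*n. sin (real K * \<theta> j) * tm_arg L (of_real r * cis (\<theta> j))) = (\<Sum>m=1..<L. s m)"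
    unfolding tm_arg_def s_def sum_distrib_left by (rule sum.swap)
  then have "\<bar>(\<Sum>j<2*n. sin (real K * \<theta> j) * tm_arg L (of_real r * cis (\<theta> j))) + (\<Sum>m=1..<L. main m)\<bar>
      = \<bar>\<Sum>m=1..<L. s m + main m\<bar>"
    by (simp add: sum.distrib)
  also have "\<dots> \<le> (\<Sum>m=1..<L. 2 * real n * r ^ (n div 2) / (1 - r))"
    by (rule order.trans[OF sum_abs], rule sum_mono)
       (use sum_sin_Ln_grid[of _ K n r] assms \<open>K > 0\<close> in \<open>auto simp: s_def main_def \<theta>_def\<close>)
  also have "\<dots> \<le> real L * (2 * real n * r ^ (n div 2) / (1 - r))"
    using assms by (simp del: times_divide_eq_right) (intro mult_right_mono, auto)
  finally show ?thesis
    unfolding main \<theta>_def .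
qed

text \<open>\<open>test_fun\<close> has the four frequencies \<open>2 ^ Suc i * k\<close> with
  \<open>k\<close> from 1 to 4. At each, the main term is \<open>n\<close> times
  \<open>(7/10)^(2*k)\<close> or \<open>(7/10)^k\<close>, times
  \<open>(2 ^ (v + 1) - x) / k\<close>, where \<open>2^v\<close> is the exact power of 2 in
  \<open>k\<close> and \<open>x = 1 / 2^i\<close> is a small correction.\<close>

lemma test_fun_gain:
  fixes n i L :: nat
  assumes "i + 4 \<le> L" "2 * 2^L \<le> n" "2^i \<ge> (1000::real)"
    and small: "\<And>r. r \<in> {rad i, rad (Suc i)} \<Longrightarrow> real L * r ^ (2^L) \<le> 1/100000 * (1 - r)"
  shows "(\<Sum>j<2*n. test_fun (2 ^ Suc i * (pi * real j / real n)) *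
            (tm_arg L (of_real (rad i) * cis (pi * real j / real n)) -
             tm_arg L (of_real (rad (Suc i)) * cis (pi * real j / real n)))) \<ge> 722/1000 * real n"
proof -
  define \<theta> where "\<theta> j = pi * real j / real n" for j
  define s where "s k r = (\<Sum>j<2*n. sin (real (2 ^ Suc i * k) * \<theta> j) * tm_arg L (of_real r * cis (\<theta> j)))" for k :: nat and r
  define x :: real where "x = 1 / 2^i"
  have x: "0 \<le> x" "x \<le> 1/1000"
    using assms(3) by (auto simp: x_def field_simps)
  have le_n: "2 ^ Suc i * 4 < n"
  proof -
    have "2 ^ Suc i * 4 \<le> (2::nat) ^ L"
      using assms(1) power_increasing[of "i + 3" L "2::nat"] by (simp add: power_add)
    moreover have "(2::nat) ^ L < n"
      using assms(2) less_le_trans[of "2 ^ L" "2 * 2 ^ L" n] by simp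
    ultimately show ?thesis by linarith
  qed
  have est: "\<bar>s k r + real n * r ^ (2 ^ Suc i * k) * (2 ^ (v + 1) - x) / real k\<bar> \<le> real n / 50000"
    if "r \<in> {rad i, rad (Suc i)}" "odd d" "k = 2^v * d" "v \<le> 2" "k \<le> 4" for k v d r
  proof -
    have r: "0 < r" "r < 1"
      using that(1) rad_pos rad_less_1 by auto
    have "k > 0" using that by (auto intro!: Nat.gr0I)
    have "2 ^ Suc i * k \<le> 2 ^ Suc i * 4"
      using that by (intro mult_left_mono) auto
    then have K: "2 ^ Suc i * k < n" using le_n by linarith
    have "\<bar>s k r + real n * r ^ (2 ^ Suc i * k) * (2 ^ (Suc i + v + 1) - 2) / real (2 ^ Suc i * k)\<bar>
         \<le> real L * (2 * real n * r ^ (n div 2) / (1 - r))"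
      unfolding s_def \<theta>_def
      by (rule sum_sin_tm_arg_grid[of d]) (use that assms(1) K r in \<open>auto simp: power_add\<close>)
    also have "(2 ^ (Suc i + v + 1) - 2 :: real) = 2 ^ Suc i * (2 ^ (v + 1) - x)"
      by (simp add: x_def power_add algebra_simps)
    also have "real n * r ^ (2 ^ Suc i * k) * (2 ^ Suc i * (2 ^ (v + 1) - x)) / real (2 ^ Suc i * k)
        = real n * r ^ (2 ^ Suc i * k) * (2 ^ (v + 1) - x) / real k"
      using \<open>k > 0\<close> by (simp add: field_simps)
    also have "real L * (2 * real n * r ^ (n div 2) / (1 - r)) \<le> real L * (2 * real n * r ^ (2^L) / (1 - r))"
      using r assms(2) by (intro mult_left_mono divide_right_mono power_decreasing) auto
    also have "\<dots> = 2 * real n / (1 - r) * (real L * r ^ (2^L))"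
      by simp
    also have "\<dots> \<le> 2 * real n / (1 - r) * (1/100000 * (1 - r))"
      using small[OF that(1)] r by (intro mult_left_mono) auto
    also have "\<dots> = real n / 50000"
      using r by simp
    finally show ?thesis .
  qed
  have p: "rad i ^ (2 ^ Suc i * k) = (7/10) ^ (2 * k)" "rad (Suc i) ^ (2 ^ Suc i * k) = (7/10) ^ k" for k
    using rad_power[of i "2 * k"] rad_power[of "Suc i" k] by (simp_all only: power_Suc mult_ac)
  have expand: "(\<Sum>j<2*n. test_fun (2 ^ Suc i * \<theta> j) * tm_arg L (of_real r * cis (\<theta> j)))
      = 65/100 * s 1 r + 71/100 * s 2 r - 33/100 * s 3 r + 40/100 * s 4 r" for r
    unfolding s_def test_fun_def sum_distrib_left sum_subtractf[symmetric] sum.distrib[symmetric]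
    by (intro sum.cong refl) (simp add: algebra_simps)
  have E1: "\<bar>s 1 (rad i) + real n * (7/10)^2 * (2 - x)\<bar> \<le> real n / 50000"
    using est[of "rad i" 1 1 0] unfolding p by simp
  have E2: "\<bar>s 2 (rad i) + real n * (7/10)^4 * (4 - x) / 2\<bar> \<le> real n / 50000"
    using est[of "rad i" 1 2 1] unfolding p by simp
  have E3: "\<bar>s 3 (rad i) + real n * (7/10)^6 * (2 - x) / 3\<bar> \<le> real n / 50000"
    using est[of "rad i" 3 3 0] unfolding p by simp
  have E4: "\<bar>s 4 (rad i) + real n * (7/10)^8 * (8 - x) / 4\<bar> \<le> real n / 50000"
    using est[of "rad i" 1 4 2] unfolding p by simp
  have F1: "\<bar>s 1 (rad (Suc i)) + real n * (7/10) * (2 - x)\<bar> \<le> real n / 50000"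
    using est[of "rad (Suc i)" 1 1 0] unfolding p by simp
  have F2: "\<bar>s 2 (rad (Suc i)) + real n * (7/10)^2 * (4 - x) / 2\<bar> \<le> real n / 50000"
    using est[of "rad (Suc i)" 1 2 1] unfolding p by simp
  have F3: "\<bar>s 3 (rad (Suc i)) + real n * (7/10)^3 * (2 - x) / 3\<bar> \<le> real n / 50000"
    using est[of "rad (Suc i)" 3 3 0] unfolding p by simp
  have F4: "\<bar>s 4 (rad (Suc i)) + real n * (7/10)^4 * (8 - x) / 4\<bar> \<le> real n / 50000"
    using est[of "rad (Suc i)" 1 4 2] unfolding p by simp
  define y where "y = real n * x"
  have y: "0 \<le> y" "y \<le> real n / 1000"
    using x mult_left_mono[of x "1/1000" "real n"] by (auto simp: y_def)
  have lin: "real n * a * (c - x) / b = a * c / b * real n - a / b * y"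
    "real n * a * (c - x) = a * c * real n - a * y" for a b c
    by (simp_all add: y_def algebra_simps diff_divide_distrib)
  \<comment> \<open>With \<open>x = 0\<close> the main terms give about \<open>0.7242 * n\<close>.
    The correction by \<open>x\<close> and the eight errors of size \<open>n / 50000\<close> fit
    into the gap down to 0.722.\<close>
  have "(65/100 * s 1 (rad i) + 71/100 * s 2 (rad i) - 33/100 * s 3 (rad i) + 40/100 * s 4 (rad i))
    - (65/100 * s 1 (rad (Suc i)) + 71/100 * s 2 (rad (Suc i)) - 33/100 * s 3 (rad (Suc i)) + 40/100 * s 4 (rad (Suc i)))
    \<ge> 722/1000 * real n"
    using abs_le_D2[OF E1[unfolded lin]] abs_le_D2[OF E2[unfolded lin]]
      abs_le_D1[OF E3[unfolded lin]] abs_le_D2[OF E4[unfolded lin]]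
      abs_le_D1[OF F1[unfolded lin]] abs_le_D1[OF F2[unfolded lin]]
      abs_le_D2[OF F3[unfolded lin]] abs_le_D1[OF F4[unfolded lin]] y
    by (simp add: field_simps)
  then show ?thesis
    unfolding expand[symmetric] by (simp add: \<theta>_def right_diff_distrib sum_subtractf)
qed

section \<open>Zeros on a segment of a ray\<close>

lemma norm_Ln_one_plus_le:
  fixes z :: complex
  assumes "norm z \<le> 1/2"
  shows "norm (Ln (1 + z)) \<le> 2 * norm z"
proof -
  have "norm z ^ 2 / (1 - norm z) \<le> norm z"
    using assms mult_left_mono[of "norm z" "1 - norm z" "norm z"]
    by (simp add: divide_le_eq power2_eq_square)
  then have "norm (Ln (1 + z) - z) \<le> norm z"
    using Ln_approx_linear[of z] assms by simp
  then show ?thesis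
    using norm_triangle_sub[of "Ln (1 + z)" z] by simp
qed

text \<open>The factor with \<open>m = 0\<close> is left out, since \<open>1 - c * z\<close>
  replaces it and is treated separately.\<close>

definition tm_prod :: "nat \<Rightarrow> complex \<Rightarrow> complex" where
  "tm_prod L z = (\<Prod>m=1..<L. 1 - z ^ (2^m))"

lemma one_minus_power_notin_nonpos_Reals:
  fixes z :: complex
  assumes "norm z < 1" "k > 0"
  shows "1 - z ^ k \<notin> \<real>\<^sub>\<le>\<^sub>0"
proof -
  have "norm (z ^ k) < 1"
    using assms by (simp add: norm_power power_less_one_iff)
  then have "Re (1 - z ^ k) > 0"
    using complex_Re_le_cmod[of "z ^ k"] by simp
  then show ?thesis
    by (auto simp: complex_nonpos_Reals_iff)
qed

lemma polar_Ln:
  assumes "w \<noteq> 0"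
  shows "w = of_real (norm w) * cis (Im (Ln w))"
  using assms exp_eq_polar[of "Ln w"] by simp

lemma tm_prod_polar:
  assumes "norm z < 1"
  shows "tm_prod L z = of_real (norm (tm_prod L z)) * cis (tm_arg L z)"
proof (induction L)
  case 0
  then show ?case by (simp add: tm_prod_def tm_arg_def)
next
  case (Suc L)
  show ?case
  proof (cases "L = 0")
    case True
    then show ?thesis by (simp add: tm_prod_def tm_arg_def)
  next
    case False
    define w where "w = 1 - z ^ (2^L)"
    have "w \<noteq> 0"
      using one_minus_power_notin_nonpos_Reals[OF assms, of "2^L"] by (auto simp: w_def)
    have step: "tm_prod (Suc L) z = tm_prod L z * w" "tm_arg (Suc L) z = tm_arg L z + Im (Ln w)"
      using False by (simp_all add: tm_prod_def tm_arg_def w_def)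
    have "tm_prod (Suc L) z = (of_real (norm (tm_prod L z)) * cis (tm_arg L z)) * (of_real (norm w) * cis (Im (Ln w)))"
      unfolding step(1) using Suc.IH polar_Ln[OF \<open>w \<noteq> 0\<close>] by metis
    also have "\<dots> = of_real (norm (tm_prod (Suc L) z)) * cis (tm_arg (Suc L) z)"
      unfolding step by (simp add: norm_mult flip: cis_mult)
    finally show ?thesis .
  qed
qed

text \<open>Each factor has modulus at least \<open>1 - norm z\<close>. The truncation error of the
  polynomial is measured against this bound.\<close>

lemma norm_tm_prod_ge:
  assumes "norm z < 1"
  shows "norm (tm_prod L z) \<ge> (1 - norm z) ^ L"
proof -
  have "(1 - norm z) ^ L \<le> (1 - norm z) ^ (L - 1)"
    using assms by (intro power_decreasing) auto
  also have "\<dots> = (\<Prod>m=1..<L. 1 - norm z)"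
    by simp
  also have "\<dots> \<le> (\<Prod>m=1..<L. norm (1 - z ^ (2^m)))"
  proof (intro prod_mono conjI)
    fix m
    have "norm z ^ (2^m) \<le> norm z ^ 1"
      using assms by (intro power_decreasing) auto
    then show "1 - norm z \<le> norm (1 - z ^ (2^m))"
      using norm_triangle_ineq2[of 1 "z ^ (2^m)"] by (simp add: norm_power)
  qed (use assms in auto)
  finally show ?thesis
    by (simp add: tm_prod_def prod_norm)
qed

lemma continuous_on_tm_arg_ray:
  assumes "norm \<omega> = 1" "0 \<le> a" "b < 1"
  shows "continuous_on {a..b} (\<lambda>r. tm_arg L (of_real r * \<omega>))"
  unfolding tm_arg_def
proof (intro continuous_intros)
  fix m r
  assume "r \<in> {a..b}"
  then show "1 - (of_real r * \<omega>) ^ (2^m) \<notin> \<real>\<^sub>\<le>\<^sub>0"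
    using assms by (intro one_minus_power_notin_nonpos_Reals) (auto simp: norm_mult)
qed

text \<open>The quotient of \<open>G\<close> by \<open>W * tm_prod L\<close> stays near 1 and hardly
  affects the argument. So the argument of \<open>cis \<tau> * G\<close> is essentially
  \<open>\<tau> + \<psi> + tm_arg\<close>, and the real part vanishes whenever it is
  \<open>pi / 2\<close> modulo \<open>pi\<close>. The real number \<open>x\<close> may be negative,
  as only arguments modulo \<open>pi\<close> matter.\<close>

lemma zeros_on_ray_segment:
  fixes G :: "complex \<Rightarrow> complex" and \<omega> W :: complex and a b x \<psi> \<tau> \<epsilon> :: real
  assumes "0 \<le> a" "a < b" "b < 1" "norm \<omega> = 1"
    and cont: "continuous_on {a..b} (\<lambda>r. G (of_real r * \<omega>))"
    and W: "W = of_real x * cis \<psi>" "W \<noteq> 0" and \<epsilon>: "0 < \<epsilon>" "\<epsilon> \<le> 1/2"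
    and near: "\<And>r. r \<in> {a..b} \<Longrightarrow>
      norm (G (of_real r * \<omega>) - W * tm_prod L (of_real r * \<omega>)) \<le> \<epsilon> * norm (W * tm_prod L (of_real r * \<omega>))"
  defines "ta \<equiv> tm_arg L (of_real a * \<omega>) / pi" and "tb \<equiv> tm_arg L (of_real b * \<omega>) / pi"
    and "\<beta> \<equiv> (\<tau> + \<psi>) / pi - 1/2"
  shows "\<exists>R. finite R \<and> R \<subseteq> {a<..<b} \<and> (\<forall>r\<in>R. Re (cis \<tau> * G (of_real r * \<omega>)) = 0) \<and>
           \<lfloor>max ta tb - \<epsilon> + \<beta>\<rfloor> - \<lfloor>min ta tb + \<epsilon> + \<beta>\<rfloor> \<le> int (card R)"
proof -
  have nz: "tm_prod L (of_real r * \<omega>) \<noteq> 0" if "r \<in> {a..b}" for r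
  proof -
    have "0 < (1 - norm (of_real r * \<omega>)) ^ L"
      using that assms by (simp add: norm_mult)
    then show ?thesis
      using norm_tm_prod_ge[of "of_real r * \<omega>" L] that assms by (force simp: norm_mult)
  qed
  define E where "E r = G (of_real r * \<omega>) / (W * tm_prod L (of_real r * \<omega>))" for r :: real
  have E_near: "norm (E r - 1) \<le> \<epsilon>" if "r \<in> {a..b}" for r
  proof -
    have "E r - 1 = (G (of_real r * \<omega>) - W * tm_prod L (of_real r * \<omega>)) / (W * tm_prod L (of_real r * \<omega>))"
      using nz[OF that] W(2) by (simp add: E_def field_simps)
    then show ?thesis
      using near[OF that] nz[OF that] W(2) by (simp add: norm_divide divide_le_eq)
  qed
  have E_Re: "Re (E r) > 0" if "r \<in> {a..b}" for r
    using E_near[OF that] abs_Re_le_cmod[of "E r - 1"] \<epsilon> by simp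
  \<comment> \<open>The slack between 2 and \<open>pi\<close> gives the strict inequality that the
    endpoint conditions of \<open>integer_values_between\<close> require.\<close>
  have E_arg: "\<bar>Im (Ln (E r))\<bar> / pi < \<epsilon>" if "r \<in> {a..b}" for r
  proof -
    have "\<bar>Im (Ln (E r))\<bar> \<le> 2 * \<epsilon>"
      using norm_Ln_one_plus_le[of "E r - 1"] E_near[OF that] \<epsilon> abs_Im_le_cmod[of "Ln (E r)"] by simp
    also have "\<dots> < \<epsilon> * pi"
      using \<epsilon> pi_gt3 by (simp add: mult.commute)
    finally show ?thesis
      by (simp add: divide_less_eq)
  qed
  \<comment> \<open>The total argument in units of \<open>pi\<close>, shifted by 1/2, so that zeros
    of the real part occur at integer values.\<close>
  define f where "f r = (tm_arg L (of_real r * \<omega>) + Im (Ln (E r))) / pi + \<beta>" for r :: real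
  have "continuous_on {a..b} E"
    unfolding E_def tm_prod_def
    by (intro continuous_intros cont) (use nz W(2) in \<open>auto simp: tm_prod_def\<close>)
  then have "continuous_on {a..b} f"
    unfolding f_def
    by (intro continuous_intros continuous_on_tm_arg_ray assms)
       (use E_Re in \<open>fastforce simp: complex_nonpos_Reals_iff\<close>)+
  moreover have "\<bar>f a - (ta + \<beta>)\<bar> < \<epsilon>" "\<bar>f b - (tb + \<beta>)\<bar> < \<epsilon>"
    using E_arg[of a] E_arg[of b] \<open>a < b\<close> by (simp_all add: f_def ta_def tb_def add_divide_distrib)
  then have "f a < min ta tb + \<epsilon> + \<beta> \<and> max ta tb - \<epsilon> + \<beta> < f b \<or>
      f b < min ta tb + \<epsilon> + \<beta> \<and> max ta tb - \<epsilon> + \<beta> < f a"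
    by (cases "ta \<le> tb") (auto simp: max_def min_def abs_less_iff)
  ultimately obtain R where R: "finite R" "R \<subseteq> {a<..<b}" "\<And>r. r \<in> R \<Longrightarrow> f r \<in> \<int>"
    "\<lfloor>max ta tb - \<epsilon> + \<beta>\<rfloor> - \<lfloor>min ta tb + \<epsilon> + \<beta>\<rfloor> \<le> int (card R)"
    using integer_values_between[OF \<open>a < b\<close>] by metis
  have "Re (cis \<tau> * G (of_real r * \<omega>)) = 0" if rR: "r \<in> R" for r
  proof -
    have r: "r \<in> {a..b}" using rR R(2) by auto
    define P where "P = tm_prod L (of_real r * \<omega>)"
    have "norm (of_real r * \<omega>) < 1"
      using r assms by (simp add: norm_mult)
    then have P: "P = of_real (norm P) * cis (tm_arg L (of_real r * \<omega>))"
      unfolding P_def by (rule tm_prod_polar)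
    have "E r \<noteq> 0" using E_Re[OF r] by auto
    then have E: "E r = of_real (norm (E r)) * cis (Im (Ln (E r)))"
      by (rule polar_Ln)
    have "cis \<tau> * G (of_real r * \<omega>) = cis \<tau> * (W * P * E r)"
      using nz[OF r] W(2) by (simp add: E_def P_def)
    also have "\<dots> = cis \<tau> * ((of_real x * cis \<psi>) * (of_real (norm P) * cis (tm_arg L (of_real r * \<omega>))) *
        (of_real (norm (E r)) * cis (Im (Ln (E r)))))"
      using P E W(1) by metis
    also have "\<dots> = of_real (x * norm P * norm (E r)) *
        (cis \<tau> * cis \<psi> * cis (tm_arg L (of_real r * \<omega>)) * cis (Im (Ln (E r))))"
      by (simp add: mult_ac)
    also have "\<dots> = of_real (x * norm P * norm (E r)) *
        cis (\<tau> + \<psi> + tm_arg L (of_real r * \<omega>) + Im (Ln (E r)))"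
      by (simp only: cis_mult)
    also have "\<tau> + \<psi> + tm_arg L (of_real r * \<omega>) + Im (Ln (E r)) = f r * pi + pi / 2"
      by (simp add: f_def \<beta>_def field_simps)
    finally have "cis \<tau> * G (of_real r * \<omega>) = of_real (x * norm P * norm (E r)) * cis (f r * pi + pi / 2)" .
    moreover have Re_cis: "Re (of_real a * cis b) = a * cos b" for a b :: real
      by simp
    ultimately have "Re (cis \<tau> * G (of_real r * \<omega>)) = x * norm P * norm (E r) * cos (f r * pi + pi / 2)"
      using Re_cis by (simp only:)
    moreover have "cos (f r * pi + pi / 2) = 0"
    proof -
      obtain k :: int where "f r = of_int k"
        using R(3)[OF rR] by (elim Ints_cases)
      then have "sin (f r * pi) = 0"
        by (auto simp: sin_zero_iff_int2)
      then show ?thesis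
        by (simp add: cos_add)
    qed
    ultimately show ?thesis by simp
  qed
  with R show ?thesis by blast
qed

section \<open>Averaging over rotations by roots of unity\<close>

text \<open>Rounding could cost each single count up to 1, but over the shifts \<open>l / Q\<close>
  the floors sum up by Hermite's identity, so rounding costs only 1 in total. The at most one bad
  index costs a further \<open>u - v + 1\<close>.\<close>

lemma sum_counts_ge:
  fixes N :: "nat \<Rightarrow> nat" and u v \<beta> \<epsilon> :: real
  assumes "Q > 0" "v \<le> u" "\<epsilon> \<ge> 0" and bad: "card {l. l < Q \<and> \<not> good l} \<le> 1"
    and N: "\<And>l. l < Q \<Longrightarrow> good l \<Longrightarrow>
      \<lfloor>u - \<epsilon> + (\<beta> + real l / real Q)\<rfloor> - \<lfloor>v + \<epsilon> + (\<beta> + real l / real Q)\<rfloor> \<le> int (N l)"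
  shows "real (\<Sum>l<Q. N l) \<ge> (real Q - 1) * (u - v) - 2 * real Q * \<epsilon> - 2"
proof -
  define f where "f l = \<lfloor>(u - \<epsilon> + \<beta>) + real l / real Q\<rfloor> - \<lfloor>(v + \<epsilon> + \<beta>) + real l / real Q\<rfloor>" for l
  define B where "B = {l. l < Q \<and> \<not> good l}"
  have "finite B" "B \<subseteq> {..<Q}" by (auto simp: B_def)
  have "(\<Sum>l<Q. f l) = \<lfloor>real Q * (u - \<epsilon> + \<beta>)\<rfloor> - \<lfloor>real Q * (v + \<epsilon> + \<beta>)\<rfloor>"
    unfolding f_def sum_subtractf using sum_floor_shift[OF \<open>Q > 0\<close>] by simp
  also have "real_of_int \<dots> \<ge> real Q * (u - \<epsilon> + \<beta>) - 1 - real Q * (v + \<epsilon> + \<beta>)"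
    by linarith
  finally have total: "real_of_int (\<Sum>l<Q. f l) \<ge> real Q * (u - v) - 2 * real Q * \<epsilon> - 1"
    by (simp add: algebra_simps)
  have "real_of_int (\<Sum>l\<in>B. f l) \<le> (\<Sum>l\<in>B. (u - v) + 1)"
    unfolding of_int_sum
  proof (rule sum_mono)
    fix l
    show "real_of_int (f l) \<le> (u - v) + 1"
      unfolding f_def using \<open>\<epsilon> \<ge> 0\<close> by linarith
  qed
  also have "\<dots> = real (card B) * ((u - v) + 1)"
    by simp
  also have "\<dots> \<le> 1 * ((u - v) + 1)"
    using bad \<open>v \<le> u\<close> unfolding B_def by (intro mult_right_mono) auto
  finally have badsum: "real_of_int (\<Sum>l\<in>B. f l) \<le> (u - v) + 1"
    by simp
  have "(\<Sum>l\<in>{..<Q} - B. f l) \<le> (\<Sum>l\<in>{..<Q} - B. int (N l))"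
    using N by (intro sum_mono) (auto simp: f_def B_def algebra_simps)
  also have "\<dots> \<le> (\<Sum>l<Q. int (N l))"
    by (intro sum_mono2) auto
  finally have "(\<Sum>l<Q. f l) - (\<Sum>l\<in>B. f l) \<le> int (\<Sum>l<Q. N l)"
    using sum.subset_diff[OF \<open>B \<subseteq> {..<Q}\<close>, of f] by simp
  then have "real_of_int (\<Sum>l<Q. f l) - real_of_int (\<Sum>l\<in>B. f l) \<le> real (\<Sum>l<Q. N l)"
    by (metis of_int_diff of_int_le_iff of_int_of_nat_eq)
  then show ?thesis
    using total badsum by (simp add: algebra_simps)
qed

lemma cis_eq_1_imp:
  assumes "cis t = 1" "0 \<le> t" "t < 2 * pi"
  shows "t = 0"
proof -
  have "cos t = 1"
    using assms(1) by (simp add: complex_eq_iff)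
  then obtain k :: int where k: "t = of_int k * 2 * pi"
    using cos_one_2pi_int by blast
  have "of_int k * (2 * pi) < 1 * (2 * pi)" "0 * (2 * pi) \<le> of_int k * (2 * pi)"
    using assms(2,3) k by auto
  then have "of_int k < (1::real)" "(0::real) \<le> of_int k"
    using mult_right_less_imp_less[of "of_int k" "2 * pi" 1] mult_right_le_imp_le[of 0 "2 * pi" "of_int k"]
    by simp_all
  then show ?thesis
    using k by simp
qed

text \<open>If two rotations of \<open>\<omega>\<close> were both closer to 1 than half the least
  distance between distinct \<open>Q\<close>-th roots of unity, the triangle inequality would fail.
  For the other rotations, \<open>1 - c * \<omega>\<close> is bounded away from 0.\<close>

lemma rotations_near_1:
  fixes Q :: nat
  shows "\<exists>\<eta>>0. \<forall>\<omega>::complex. norm \<omega> = 1 \<longrightarrow>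
    card {l. l < Q \<and> \<not> norm (1 - cis (2 * pi * real l / real Q) * \<omega>) \<ge> \<eta>} \<le> 1"
proof -
  define c where "c l = cis (2 * pi * real l / real Q)" for l :: nat
  \<comment> \<open>Inserting 1 keeps the set nonempty for \<open>Q \<le> 1\<close>.\<close>
  define D where "D = insert 1 ((\<lambda>d. norm (1 - c d)) ` {0<..<Q})"
  have "c d \<noteq> 1" if "0 < d" "d < Q" for d
  proof
    assume "c d = 1"
    then have "2 * pi * real d / real Q = 0"
      unfolding c_def using that by (intro cis_eq_1_imp) (auto simp: field_simps)
    then show False using that by simp
  qed
  then have "Min D > 0"
    unfolding D_def by (subst Min_gr_iff) auto
  have close: "\<not> l < l'" if "l' < Q" "norm (1 - c l * \<omega>) < Min D / 2" "norm (1 - c l' * \<omega>) < Min D / 2" "norm \<omega> = 1"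
    for l l' and \<omega> :: complex
  proof
    assume "l < l'"
    then have "Min D \<le> norm (1 - c (l' - l))"
      using that(1) by (intro Min_le) (auto simp: D_def)
    also have "\<dots> = norm (c l * \<omega> * (1 - c (l' - l)))"
      using that(4) by (simp add: norm_mult c_def)
    also have "c l * \<omega> * (1 - c (l' - l)) = c l * \<omega> - c l' * \<omega>"
    proof -
      have "c l * c (l' - l) = c l'"
        using \<open>l < l'\<close> by (simp add: c_def cis_mult of_nat_diff diff_divide_distrib algebra_simps)
      then show ?thesis
        by (simp add: right_diff_distrib mult_ac)
    qed
    also have "norm (c l * \<omega> - c l' * \<omega>) \<le> norm (1 - c l * \<omega>) + norm (1 - c l' * \<omega>)"
      using norm_triangle_ineq4[of "1 - c l' * \<omega>" "1 - c l * \<omega>"] by simp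
    also have "\<dots> < Min D"
      using that by simp
    finally show False by simp
  qed
  have "card {l. l < Q \<and> \<not> norm (1 - c l * \<omega>) \<ge> Min D / 2} \<le> 1" if "norm \<omega> = 1" for \<omega>
  proof -
    have "\<forall>l\<in>{l. l < Q \<and> \<not> norm (1 - c l * \<omega>) \<ge> Min D / 2}. \<forall>l'\<in>{l. l < Q \<and> \<not> norm (1 - c l * \<omega>) \<ge> Min D / 2}. l = l'"
      using close that by (auto simp: not_le) (metis linorder_neqE_nat)
    then show ?thesis
      by (subst One_nat_def, subst card_le_Suc0_iff_eq) auto
  qed
  then show ?thesis
    using \<open>Min D > 0\<close> unfolding c_def by (intro exI[of _ "Min D / 2"]) auto
qed

text \<open>Polar form with a signed radius: the angle is linear in \<open>t\<close>, so rotating by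
  \<open>2 * pi * l / Q\<close> shifts the argument of \<open>1 - c * \<omega>\<close> by exactly
  \<open>pi * l / Q\<close> modulo \<open>pi\<close>.\<close>

lemma one_minus_cis: "1 - cis (2 * t) = of_real (2 * sin t) * cis (t - pi / 2)"
  by (simp add: complex_eq_iff cos_diff sin_diff cos_double_sin sin_double power2_eq_square)

lemma inj_on_cis_grid:
  assumes "n > 0"
  shows "inj_on (\<lambda>j. cis (pi * real j / real n)) {..<2*n}"
proof (rule linorder_inj_onI)
  fix i j :: nat
  assume ij: "i < j" "i \<in> {..<2*n}" "j \<in> {..<2*n}"
  show "cis (pi * real i / real n) \<noteq> cis (pi * real j / real n)"
  proof
    assume "cis (pi * real i / real n) = cis (pi * real j / real n)"
    then have "cis (pi * real j / real n - pi * real i / real n) = 1"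
      by (simp flip: cis_divide)
    moreover have "pi * real j / real n - pi * real i / real n = pi * real (j - i) / real n"
      using ij by (simp add: of_nat_diff diff_divide_distrib right_diff_distrib)
    moreover have "pi * real (j - i) / real n < 2 * pi"
    proof -
      have "real (j - i) < 2 * real n" using ij by auto
      then show ?thesis using assms by (simp add: field_simps)
    qed
    ultimately have "pi * real (j - i) / real n = 0"
      by (intro cis_eq_1_imp) auto
    then show False using ij assms by simp
  qed
qed auto

section \<open>Palindromic completion and the zeros in one octave\<close>

text \<open>The block \<open>a\<close> is placed at both ends, reversed at the top, and the gap is
  filled with ones. The two blocks do not overlap when \<open>2 * M \<le> n\<close>.\<close>

definition symmetric_extension :: "nat \<Rightarrow> nat \<Rightarrow> (nat \<Rightarrow> complex) \<Rightarrow> nat \<Rightarrow> complex" where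
  "symmetric_extension M n a k = (if k < M then a k else if n - k < M then a (n - k) else 1)"

lemma symmetric_extension_reflect:
  assumes "2 * M \<le> n" "k \<le> n"
  shows "symmetric_extension M n a (n - k) = symmetric_extension M n a k"
  using assms by (auto simp: symmetric_extension_def)

lemma norm_symmetric_extension:
  assumes "\<And>k. norm (a k) = 1"
  shows "norm (symmetric_extension M n a k) = 1"
  using assms by (simp add: symmetric_extension_def)

lemma symmetric_extension_tail:
  assumes "\<And>k. norm (a k) = 1" "norm z < 1" "2 * M \<le> n"
  shows "norm ((\<Sum>k\<le>n. symmetric_extension M n a k * z ^ k) - (\<Sum>k<M. a k * z ^ k)) \<le> norm z ^ M / (1 - norm z)"
proof -
  let ?A = "symmetric_extension M n a"
  have "(\<Sum>k\<le>n. ?A k * z ^ k) = (\<Sum>k<M. ?A k * z ^ k) + (\<Sum>k=M..n. ?A k * z ^ k)"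
  proof -
    have "{..n} = {..<M} \<union> {M..n}" using assms(3) by auto
    then show ?thesis by (simp add: sum.union_disjoint ivl_disj_int)
  qed
  also have "(\<Sum>k<M. ?A k * z ^ k) = (\<Sum>k<M. a k * z ^ k)"
    by (intro sum.cong) (auto simp: symmetric_extension_def)
  finally have "norm ((\<Sum>k\<le>n. ?A k * z ^ k) - (\<Sum>k<M. a k * z ^ k)) \<le> (\<Sum>k=M..n. norm (?A k * z ^ k))"
    by (simp add: norm_sum)
  also have "\<dots> = (\<Sum>k=M..n. norm z ^ k)"
    by (simp add: norm_mult norm_power norm_symmetric_extension[OF assms(1)])
  also have "\<dots> = (norm z ^ M - norm z ^ Suc n) / (1 - norm z)"
    using assms(2,3) by (subst sum_gp) auto
  also have "\<dots> \<le> norm z ^ M / (1 - norm z)"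
    using assms(2) by (intro divide_right_mono) auto
  finally show ?thesis .
qed

text \<open>Close to the unit circle, \<open>G l\<close> is
  \<open>(1 - c * \<omega>) * tm_prod L\<close> up to a relative error \<open>\<epsilon>\<close>,
  half from the tail and half from replacing \<open>z\<close> by \<open>\<omega>\<close>. The phases
  for the different \<open>l\<close> are then equally spaced modulo \<open>pi\<close>, and
  \<open>sum_counts_ge\<close> adds up the counts.\<close>

lemma zeros_per_octave:
  fixes G :: "nat \<Rightarrow> complex \<Rightarrow> complex" and n i L Q :: nat and \<epsilon> \<eta> :: real
  assumes "Q > 0" "0 < \<epsilon>" "\<epsilon> \<le> 1/2" "norm \<omega> = 1" "\<omega> = cis \<theta>"
    and bad: "card {l. l < Q \<and> \<not> norm (1 - cis (2 * pi * real l / real Q) * \<omega>) \<ge> \<eta>} \<le> 1" and "\<eta> > 0"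
    and cont: "\<And>l. continuous_on UNIV (G l)"
    and tail: "\<And>l z. l < Q \<Longrightarrow> norm z < 1 \<Longrightarrow>
       norm (G l z - (1 - cis (2 * pi * real l / real Q) * z) * tm_prod L z) \<le> norm z ^ (2^L) / (1 - norm z)"
    and small: "\<And>r. r \<in> {a..b} \<Longrightarrow> r ^ (2^L) \<le> \<epsilon> * \<eta> / 2 * (1 - r) ^ (L + 1)"
    and ab: "0 \<le> a" "a < b" "b < 1" "1 - a \<le> \<epsilon> * \<eta> / 2"
  shows "\<exists>R. (\<forall>l<Q. finite (R l) \<and> R l \<subseteq> {a<..<b} \<and> (\<forall>r\<in>R l. Re (cis (pi/3) * G l (of_real r * \<omega>)) = 0)) \<and>
     real (\<Sum>l<Q. card (R l)) \<ge>
       (real Q - 1) * (\<bar>tm_arg L (of_real a * \<omega>) - tm_arg L (of_real b * \<omega>)\<bar> / pi) - 2 * real Q * \<epsilon> - 2"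
proof -
  define c where "c l = cis (2 * pi * real l / real Q)" for l :: nat
  define ta tb where "ta = tm_arg L (of_real a * \<omega>) / pi" and "tb = tm_arg L (of_real b * \<omega>) / pi"
  \<comment> \<open>The phase for \<open>l = 0\<close>: the rotation \<open>pi/3\<close> plus the
    angle \<open>\<theta>/2 - pi/2\<close> of \<open>1 - cis \<theta>\<close>, in units of
    \<open>pi\<close>.\<close>
  define \<beta> where "\<beta> = (pi/3 + (\<theta>/2 - pi/2)) / pi - 1/2"
  have good: "\<exists>R. finite R \<and> R \<subseteq> {a<..<b} \<and> (\<forall>r\<in>R. Re (cis (pi/3) * G l (of_real r * \<omega>)) = 0) \<and>
           \<lfloor>max ta tb - \<epsilon> + (\<beta> + real l / real Q)\<rfloor> - \<lfloor>min ta tb + \<epsilon> + (\<beta> + real l / real Q)\<rfloor> \<le> int (card R)"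
    if l: "l < Q" "norm (1 - c l * \<omega>) \<ge> \<eta>" for l
  proof -
    define t where "t = \<theta>/2 + pi * real l / real Q"
    have "c l * \<omega> = cis (2 * t)"
      by (simp add: c_def assms(5) cis_mult t_def algebra_simps)
    then have W: "1 - c l * \<omega> = of_real (2 * sin t) * cis (t - pi / 2)"
      using one_minus_cis by simp
    have W0: "1 - c l * \<omega> \<noteq> 0"
      using l(2) \<open>\<eta> > 0\<close> by auto
    have near: "norm (G l (of_real r * \<omega>) - (1 - c l * \<omega>) * tm_prod L (of_real r * \<omega>))
        \<le> \<epsilon> * norm ((1 - c l * \<omega>) * tm_prod L (of_real r * \<omega>))" if r: "r \<in> {a..b}" for r
    proof -
      define z P where "z = of_real r * \<omega>" and "P = tm_prod L z"
      have nz: "norm z = r" "r < 1" "0 \<le> r" using r ab assms(4) by (auto simp: z_def norm_mult)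
      have P: "(1 - r) ^ L \<le> norm P"
        unfolding P_def using norm_tm_prod_ge[of z L] nz by simp
      have "norm (G l z - (1 - c l * z) * P) \<le> r ^ (2^L) / (1 - r)"
        using tail[of l z] l nz by (simp add: P_def c_def)
      \<comment> \<open>One of the \<open>L + 1\<close> factors \<open>1 - r\<close> pays for the
        geometric tail; the other \<open>L\<close> bound the product from below.\<close>
      also have "\<dots> \<le> \<epsilon> * \<eta> / 2 * (1 - r) ^ L"
        using small[OF r] nz by (simp add: divide_le_eq mult_ac)
      also have "\<dots> \<le> \<epsilon> * \<eta> / 2 * norm P"
        using P \<open>\<epsilon> > 0\<close> \<open>\<eta> > 0\<close> by (intro mult_left_mono) auto
      finally have 1: "norm (G l z - (1 - c l * z) * P) \<le> \<epsilon> * \<eta> / 2 * norm P" .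
      have "(1 - c l * z) * P - (1 - c l * \<omega>) * P = of_real (1 - r) * (c l * \<omega> * P)"
        by (simp add: z_def algebra_simps)
      then have "norm ((1 - c l * z) * P - (1 - c l * \<omega>) * P) = (1 - r) * norm P"
        using nz assms(4) by (simp add: norm_mult c_def del: of_real_diff)
      also have "\<dots> \<le> \<epsilon> * \<eta> / 2 * norm P"
        using r ab by (intro mult_right_mono) auto
      finally have "norm (G l z - (1 - c l * \<omega>) * P) \<le> \<epsilon> * \<eta> * norm P"
        using 1 norm_triangle_ineq[of "G l z - (1 - c l * z) * P" "(1 - c l * z) * P - (1 - c l * \<omega>) * P"]
        by simp
      also have "\<dots> \<le> \<epsilon> * norm ((1 - c l * \<omega>) * P)"
        using l(2) \<open>\<epsilon> > 0\<close> by (simp add: norm_mult mult_right_mono)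
      finally show ?thesis
        unfolding z_def P_def .
    qed
    have \<beta>: "(pi/3 + (t - pi/2)) / pi - 1/2 = \<beta> + real l / real Q"
      by (simp add: \<beta>_def t_def add_divide_distrib diff_divide_distrib)
    have "continuous_on {a..b} (\<lambda>r. G l (of_real r * \<omega>))"
      by (rule continuous_on_compose2[OF cont]) (auto intro!: continuous_intros)
    then show ?thesis
      unfolding ta_def tb_def \<beta>[symmetric]
      by (intro zeros_on_ray_segment[OF ab(1-3) assms(4) _ W W0 assms(2,3)] near)
  qed
  \<comment> \<open>A bad \<open>l\<close> is allowed the empty set, so one family \<open>R\<close>
    serves all indices.\<close>
  define P where "P l R \<longleftrightarrow> finite R \<and> R \<subseteq> {a<..<b} \<and> (\<forall>r\<in>R. Re (cis (pi/3) * G l (of_real r * \<omega>)) = 0) \<and>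
     (norm (1 - c l * \<omega>) \<ge> \<eta> \<longrightarrow>
       \<lfloor>max ta tb - \<epsilon> + (\<beta> + real l / real Q)\<rfloor> - \<lfloor>min ta tb + \<epsilon> + (\<beta> + real l / real Q)\<rfloor> \<le> int (card R))"
    for l R
  have "\<exists>R. P l R" if "l < Q" for l
  proof (cases "norm (1 - c l * \<omega>) \<ge> \<eta>")
    case True
    then show ?thesis using good[OF that] unfolding P_def by blast
  next
    case False
    then show ?thesis unfolding P_def by (intro exI[of _ "{}"]) auto
  qed
  then obtain R where R: "\<And>l. l < Q \<Longrightarrow> P l (R l)"
    by metis
  have "real (\<Sum>l<Q. card (R l)) \<ge> (real Q - 1) * (max ta tb - min ta tb) - 2 * real Q * \<epsilon> - 2"
    by (rule sum_counts_ge[where good = "\<lambda>l. norm (1 - c l * \<omega>) \<ge> \<eta>"])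
       (use R assms(1,2) bad in \<open>auto simp: P_def c_def\<close>)
  also have "max ta tb - min ta tb = \<bar>tm_arg L (of_real a * \<omega>) - tm_arg L (of_real b * \<omega>)\<bar> / pi"
    unfolding ta_def tb_def by (auto simp: max_def min_def abs_if field_simps)
  finally show ?thesis
    using R unfolding P_def by (intro exI[of _ R]) auto
qed

section \<open>Zeros of the harmonic polynomial\<close>

definition palindromic_unimodular :: "nat \<Rightarrow> (nat \<Rightarrow> complex) \<Rightarrow> bool" where
  "palindromic_unimodular n A \<longleftrightarrow> (\<forall>k. norm (A k) = 1) \<and> A 0 = 1 \<and> (\<forall>k\<le>n. A (n - k) = A k)"

text \<open>For palindromic unimodular \<open>A\<close>, these points are zeros of the harmonic
  polynomial by \<open>harmonic_zero_on_rays\<close>. Leaving out 0 makes each of them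
  invertible.\<close>

definition disc_zeros :: "nat \<Rightarrow> (nat \<Rightarrow> complex) \<Rightarrow> complex set" where
  "disc_zeros n A = {z. 0 < norm z \<and> norm z < 1 \<and> z ^ n \<in> \<real> \<and> Re (cis (pi/3) * (\<Sum>k\<le>n. A k * z ^ k)) = 0}"

text \<open>The counts are summed over rays, octaves and all \<open>Q\<close> rotations, and a
  rotation with at least the average count is kept. The factor 39/40 and the summand
  \<open>i0\<close> record the octaves dropped at the outer and inner end.\<close>

lemma many_zeros_in_disc:
  "\<exists>L0 i0 :: nat. \<forall>L\<ge>L0. \<forall>n. 2 * 2^L \<le> n \<longrightarrow>
     (\<exists>A Z. palindromic_unimodular n A \<and> finite Z \<and> Z \<subseteq> disc_zeros n A \<and>
        real (card Z) \<ge> 7195/10000 / pi * real n * (39/40 * real L - real i0))"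
proof -
  \<comment> \<open>\<open>Q\<close> is large enough that a bounded loss per ray is negligible after
    division by \<open>Q\<close>; \<open>\<epsilon>\<close> is \<open>1 / (2 * Q)\<close>, so
    \<open>2 * Q * \<epsilon> = 1\<close>.\<close>
  define Q :: nat where "Q = 10000"
  define \<epsilon> :: real where "\<epsilon> = 1/20000"
  obtain \<eta> :: real where \<eta>: "\<eta> > 0" and bad: "\<And>\<omega>::complex. norm \<omega> = 1 \<Longrightarrow>
      card {l. l < Q \<and> \<not> norm (1 - cis (2 * pi * real l / real Q) * \<omega>) \<ge> \<eta>} \<le> 1"
    using rotations_near_1[of Q] by blast
  \<comment> \<open>One bound for two uses: the error in \<open>test_fun_gain\<close> and the tail
    in \<open>zeros_per_octave\<close>.\<close>
  define \<mu> where "\<mu> = min (1/100000) (\<epsilon> * \<eta> / 2)"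
  have "\<mu> > 0" using \<eta> by (simp add: \<mu>_def \<epsilon>_def)
  \<comment> \<open>From octave \<open>i0\<close> on,
    \<open>1 - rad i \<le> \<epsilon> * \<eta> / 2\<close> and
    \<open>2^i \<ge> 1000\<close>.\<close>
  obtain i0 where i0: "max 1000 (2 / (\<epsilon> * \<eta>)) < (2::real) ^ i0"
    using real_arch_pow[of 2 "max 1000 (2 / (\<epsilon> * \<eta>))"] by (meson one_less_numeral_iff semiring_norm(76))
  obtain L1 where L1: "\<And>L r. L \<ge> L1 \<Longrightarrow> 0 \<le> r \<Longrightarrow> r \<le> rad (L - L div 40) \<Longrightarrow>
      real L * r ^ (2^L) \<le> \<mu> * (1 - r) ^ (L + 1)"
    using rad_tail_negligible[OF \<open>\<mu> > 0\<close>] unfolding eventually_sequentially by blast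
  have main: "\<exists>A Z. palindromic_unimodular n A \<and> finite Z \<and> Z \<subseteq> disc_zeros n A \<and>
        real (card Z) \<ge> 7195/10000 / pi * real n * (39/40 * real L - real i0)"
    \<comment> \<open>With \<open>L \<ge> 160\<close>, \<open>L div 40\<close> is at least 4, which
      yields \<open>i + 4 \<le> L\<close> for the octaves in \<open>I\<close>.\<close>
    if L: "L \<ge> max L1 160" and n: "2 * 2^L \<le> n" for L n :: nat
  proof -
    define I where "I = {i0..<L - L div 40}"
    define c where "c l = cis (2 * pi * real l / real Q)" for l :: nat
    define \<theta> where "\<theta> j = pi * real j / real n" for j :: nat
    have "n > 0" using n by (cases n) auto
    have "L \<ge> 1" using L by simp
    have "\<exists>a::nat \<Rightarrow> complex. (\<forall>k. norm (a k) = 1) \<and> a 0 = 1 \<and>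
           (\<forall>z. (\<Sum>k<2^L. a k * z^k) = (1 - c l * z) * tm_prod L z)" for l
      unfolding tm_prod_def by (rule thue_morse_type_coeffs[OF _ \<open>L \<ge> 1\<close>]) (simp add: c_def)
    then obtain a :: "nat \<Rightarrow> nat \<Rightarrow> complex" where a: "\<And>l k. norm (a l k) = 1" "\<And>l. a l 0 = 1"
        "\<And>l z. (\<Sum>k<2^L. a l k * z^k) = (1 - c l * z) * tm_prod L z"
      by metis
    define A where "A l = symmetric_extension (2^L) n (a l)" for l
    define G where "G l z = (\<Sum>k\<le>n. A l k * z ^ k)" for l z
    have tail: "norm (G l z - (1 - c l * z) * tm_prod L z) \<le> norm z ^ (2^L) / (1 - norm z)" if "norm z < 1" for l z
      unfolding G_def A_def a(3)[symmetric]
      by (rule symmetric_extension_tail[OF a(1) that n])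
    have small: "real L * r ^ (2^L) \<le> \<mu> * (1 - r) ^ (L + 1)" if "0 \<le> r" "r \<le> rad (Suc i)" "i \<in> I" for r i
    proof -
      have "rad (Suc i) \<le> rad (L - L div 40)"
        using that(3) by (intro rad_mono) (auto simp: I_def)
      then show ?thesis using L1[of L r] L that by auto
    qed
    define \<Delta> where "\<Delta> j i = tm_arg L (of_real (rad i) * cis (\<theta> j)) - tm_arg L (of_real (rad (Suc i)) * cis (\<theta> j))" for j i
    define zero_sets where "zero_sets j i R \<longleftrightarrow>
        (\<forall>l<Q. finite (R l) \<and> R l \<subseteq> {rad i<..<rad (Suc i)} \<and>
             (\<forall>r\<in>R l. Re (cis (pi/3) * G l (of_real r * cis (\<theta> j))) = 0)) \<and>
        real (\<Sum>l<Q. card (R l)) \<ge> (real Q - 1) * (\<bar>\<Delta> j i\<bar> / pi) - 2 * real Q * \<epsilon> - 2" for j i R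
    have ex: "\<exists>R. zero_sets j i R" if iI: "i \<in> I" for i j
    proof -
      have "1 - rad i \<le> 1 / 2 ^ i" by (rule one_minus_rad_le)
      also have "\<dots> \<le> 1 / 2 ^ i0"
        using iI by (intro divide_left_mono power_increasing) (auto simp: I_def)
      also have "\<dots> \<le> \<epsilon> * \<eta> / 2"
        using i0 \<eta> by (auto simp: \<epsilon>_def field_simps)
      finally have close: "1 - rad i \<le> \<epsilon> * \<eta> / 2" .
      have "r ^ (2^L) \<le> \<epsilon> * \<eta> / 2 * (1 - r) ^ (L + 1)" if r: "r \<in> {rad i..rad (Suc i)}" for r
      proof -
        have r01: "0 \<le> r" "r < 1" using r rad_pos[of i] rad_less_1[of "Suc i"] by auto
        have "1 * r ^ (2^L) \<le> real L * r ^ (2^L)"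
          using r01 \<open>L \<ge> 1\<close> by (intro mult_right_mono) auto
        also have "\<dots> \<le> \<mu> * (1 - r) ^ (L + 1)"
          using small[of r i] r01 r iI by auto
        also have "\<dots> \<le> \<epsilon> * \<eta> / 2 * (1 - r) ^ (L + 1)"
          using r01 by (intro mult_right_mono) (auto simp: \<mu>_def)
        finally show ?thesis by simp
      qed
      moreover have "continuous_on UNIV (G l)" for l
        unfolding G_def by (intro continuous_intros)
      ultimately show ?thesis
        unfolding \<Delta>_def zero_sets_def
        using zeros_per_octave[of Q \<epsilon> "cis (\<theta> j)" "\<theta> j" \<eta> G L "rad i" "rad (Suc i)"] bad[of "cis (\<theta> j)"] \<eta>
          tail[unfolded c_def] close rad_pos[of i] rad_less_1[of "Suc i"] rad_strict_mono[of i "Suc i"]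
        by (auto simp: Q_def \<epsilon>_def)
    qed
    define R where "R j i = (SOME R. zero_sets j i R)" for j i
    have "zero_sets j i (R j i)" if "i \<in> I" for j i
      unfolding R_def by (rule someI_ex[OF ex[OF that]])
    then have R: "\<And>j i l. i \<in> I \<Longrightarrow> l < Q \<Longrightarrow> finite (R j i l) \<and> R j i l \<subseteq> {rad i<..<rad (Suc i)} \<and>
             (\<forall>r\<in>R j i l. Re (cis (pi/3) * G l (of_real r * cis (\<theta> j))) = 0)"
        and R_card: "\<And>j i. i \<in> I \<Longrightarrow>
          real (\<Sum>l<Q. card (R j i l)) \<ge> (real Q - 1) * (\<bar>\<Delta> j i\<bar> / pi) - 2 * real Q * \<epsilon> - 2"
      unfolding zero_sets_def by simp_all
    have octave: "real (\<Sum>j<2*n. \<Sum>l<Q. card (R j i l)) \<ge> 7195 / pi * real n" if "i \<in> I" for i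
    proof -
      have "722/1000 * real n \<le> (\<Sum>j<2*n. test_fun (2 ^ Suc i * \<theta> j) * \<Delta> j i)"
        unfolding \<theta>_def \<Delta>_def
      proof (rule test_fun_gain)
        show "i + 4 \<le> L"
          using that L by (auto simp: I_def)
        have "(2::real) ^ i0 \<le> 2 ^ i"
          using that by (intro power_increasing) (auto simp: I_def)
        moreover have "(1000::real) < 2 ^ i0"
          using i0 by simp
        ultimately show "(1000::real) \<le> 2 ^ i"
          by linarith
        fix r assume r: "r \<in> {rad i, rad (Suc i)}"
        then have r01: "0 \<le> r" "r < 1" "r \<le> rad (Suc i)"
          using rad_pos rad_less_1 rad_mono[of i "Suc i"] by (auto simp: less_imp_le)
        have "real L * r ^ (2^L) \<le> \<mu> * (1 - r) ^ (L + 1)"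
          using small[OF r01(1,3) that] .
        also have "\<dots> \<le> 1/100000 * (1 - r)"
          using r01 \<open>\<mu> > 0\<close> power_decreasing[of 1 "L + 1" "1 - r"] by (intro mult_mono) (auto simp: \<mu>_def)
        finally show "real L * r ^ (2^L) \<le> 1/100000 * (1 - r)" .
      qed (rule n)
      also have "\<dots> \<le> (\<Sum>j<2*n. \<bar>\<Delta> j i\<bar>)"
      proof (rule sum_mono)
        fix j
        show "test_fun (2 ^ Suc i * \<theta> j) * \<Delta> j i \<le> \<bar>\<Delta> j i\<bar>"
          using abs_test_fun_le_1[of "2 ^ Suc i * \<theta> j"]
            mult_right_mono[of "\<bar>test_fun (2 ^ Suc i * \<theta> j)\<bar>" 1 "\<bar>\<Delta> j i\<bar>"]
          by (simp flip: abs_mult)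
      qed
      finally have \<Delta>: "722/1000 * real n \<le> (\<Sum>j<2*n. \<bar>\<Delta> j i\<bar>)" .
      have "7195 / pi * real n = 7195 * real n / pi"
        by simp
      \<comment> \<open>The loss is 3 on each of the \<open>2*n\<close> rays, hence
        \<open>6 * n\<close>; with \<open>pi < 4\<close>, the inequality
        \<open>9999 * 0.722 - 24 \<ge> 7195\<close> suffices.\<close>
      also have "\<dots> \<le> (9999 * (722/1000) - 6 * pi) * real n / pi"
        using pi_less_4 by (intro divide_right_mono mult_right_mono) auto
      also have "\<dots> = 9999 / pi * (722/1000 * real n) - 6 * real n"
        by (simp add: field_simps)
      also have "\<dots> \<le> 9999 / pi * (\<Sum>j<2*n. \<bar>\<Delta> j i\<bar>) - 6 * real n"
        using \<Delta> by (intro diff_right_mono mult_left_mono) auto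
      also have "\<dots> = (\<Sum>j<2*n. (real Q - 1) * (\<bar>\<Delta> j i\<bar> / pi) - 2 * real Q * \<epsilon> - 2)"
        by (simp add: Q_def \<epsilon>_def sum_subtractf sum_distrib_left)
      also have "\<dots> \<le> (\<Sum>j<2*n. real (\<Sum>l<Q. card (R j i l)))"
        using R_card[OF that] by (intro sum_mono)
      finally show ?thesis by simp
    qed
    define N where "N l = (\<Sum>j<2*n. \<Sum>i\<in>I. card (R j i l))" for l
    have "real (card I) * (7195 / pi * real n) = (\<Sum>i\<in>I. 7195 / pi * real n)"
      by simp
    also have "\<dots> \<le> (\<Sum>i\<in>I. real (\<Sum>j<2*n. \<Sum>l<Q. card (R j i l)))"
      by (intro sum_mono octave)
    also have "\<dots> = real (\<Sum>i\<in>I. \<Sum>j<2*n. \<Sum>l<Q. card (R j i l))"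
      by simp
    also have "(\<Sum>i\<in>I. \<Sum>j<2*n. \<Sum>l<Q. card (R j i l)) = (\<Sum>l<Q. N l)"
      unfolding N_def by (subst sum.swap, subst (2) sum.swap, subst sum.swap) (rule refl)
    finally have total: "real (card I) * (7195 / pi * real n) \<le> (\<Sum>l<Q. real (N l))"
      by simp
    \<comment> \<open>Pigeonhole: some rotation reaches the average over all \<open>Q\<close> of
      them.\<close>
    have "\<exists>l<Q. real (N l) \<ge> real (card I) * (7195/10000 / pi * real n)"
    proof (rule ccontr)
      assume "\<not> ?thesis"
      then have "(\<Sum>l<Q. real (N l)) < (\<Sum>l<Q. real (card I) * (7195/10000 / pi * real n))"
        by (intro sum_strict_mono) (auto simp: Q_def not_le lessThan_empty_iff)
      then show False using total by (simp add: Q_def mult_ac)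
    qed
    then obtain l where l: "l < Q" and Nl: "real (N l) \<ge> real (card I) * (7195/10000 / pi * real n)"
      by blast
    define T where "T = (SIGMA j:{..<2*n}. SIGMA i:I. R j i l)"
    define Z where "Z = (\<lambda>(j, i, r). of_real r * cis (\<theta> j)) ` T"
    have fin: "finite I" "\<And>j i. i \<in> I \<Longrightarrow> finite (R j i l)"
      using R l by (auto simp: I_def)
    have T: "r > 0 \<and> r < 1 \<and> rad i < r \<and> r < rad (Suc i) \<and> i \<in> I \<and> j < 2*n" if "(j, i, r) \<in> T" for j i r
      using that R[of i l j] l rad_pos[of i] rad_less_1[of "Suc i"] unfolding T_def by fastforce
    \<comment> \<open>The modulus recovers \<open>r\<close> and, the open octaves being disjoint,
      also \<open>i\<close>; the direction recovers \<open>j\<close>.\<close>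
    have "inj_on (\<lambda>(j, i, r). of_real r * cis (\<theta> j)) T"
    proof (rule inj_onI)
      fix x y
      assume xy: "x \<in> T" "y \<in> T" and
        f_eq: "(case x of (j, i, r) \<Rightarrow> of_real r * cis (\<theta> j)) = (case y of (j, i, r) \<Rightarrow> of_real r * cis (\<theta> j))"
      obtain j i r j' i' r' where x: "x = (j, i, r)" and y: "y = (j', i', r')"
        by (metis prod.exhaust)
      have t: "(j, i, r) \<in> T" "(j', i', r') \<in> T" and eq: "of_real r * cis (\<theta> j) = of_real r' * cis (\<theta> j')"
        using xy f_eq unfolding x y by simp_all
      have "norm (of_real r * cis (\<theta> j)) = norm (of_real r' * cis (\<theta> j'))"
        using eq by simp
      then have r: "r = r'"
        using T[OF t(1)] T[OF t(2)] by (simp add: norm_mult)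
      then have "cis (\<theta> j) = cis (\<theta> j')"
        using eq T[OF t(1)] by simp
      then have "j = j'"
        using inj_on_cis_grid[OF \<open>n > 0\<close>] T[OF t(1)] T[OF t(2)] by (auto simp: \<theta>_def inj_on_def)
      moreover have "i = i'"
      proof (rule ccontr)
        assume "i \<noteq> i'"
        then have "Suc i \<le> i' \<or> Suc i' \<le> i" by linarith
        then have "rad (Suc i) \<le> rad i' \<or> rad (Suc i') \<le> rad i" using rad_mono by blast
        then show False using T[OF t(1)] T[OF t(2)] r by auto
      qed
      ultimately show "x = y" using r by (simp add: x y)
    qed
    then have "card Z = card T"
      unfolding Z_def by (rule card_image)
    also have "\<dots> = (\<Sum>j<2*n. card (SIGMA i:I. R j i l))"
      unfolding T_def using fin by (intro card_SigmaI) auto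
    also have "\<dots> = N l"
      unfolding N_def using fin by (intro sum.cong refl card_SigmaI) auto
    finally have card_Z: "card Z = N l" .
    have "finite T"
      unfolding T_def using fin by (intro finite_SigmaI) auto
    then have "finite Z" by (simp add: Z_def)
    have Z: "0 < norm z \<and> norm z < 1 \<and> z ^ n \<in> \<real> \<and> Re (cis (pi/3) * G l z) = 0" if "z \<in> Z" for z
    proof -
      obtain j i r where jir: "(j, i, r) \<in> T" and z: "z = of_real r * cis (\<theta> j)"
        using \<open>z \<in> Z\<close> by (auto simp: Z_def)
      have "real n * \<theta> j = real j * pi"
        using \<open>n > 0\<close> by (simp add: \<theta>_def)
      then have "cis (\<theta> j) ^ n = (-1) ^ j"
        unfolding Complex.DeMoivre by (simp add: complex_eq_iff)
      then have "z ^ n = of_real (r ^ n * (-1) ^ j)"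
        by (simp add: z power_mult_distrib)
      then have "z ^ n \<in> \<real>"
        by (simp only: Reals_of_real)
      moreover have "Re (cis (pi/3) * G l z) = 0"
        using R[of i l j] l jir unfolding T_def z by auto
      ultimately show ?thesis
        using T[OF jir] by (simp add: z norm_mult)
    qed
    have "39/40 * real L - real i0 \<le> real (card I)"
    proof -
      have "L \<le> card I + i0 + L div 40"
        by (simp add: I_def)
      then have "real L \<le> real (card I) + real i0 + real (L div 40)"
        by (simp flip: of_nat_add)
      moreover have "real (L div 40) \<le> real L / 40"
        by linarith
      ultimately show ?thesis
        by simp
    qed
    then have "7195/10000 / pi * real n * (39/40 * real L - real i0) \<le> 7195/10000 / pi * real n * real (card I)"
      by (intro mult_left_mono) auto
    also have "\<dots> \<le> real (card Z)"
      using Nl card_Z by (simp add: mult_ac)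
    finally have "7195/10000 / pi * real n * (39/40 * real L - real i0) \<le> real (card Z)" .
    moreover have "palindromic_unimodular n (A l)"
      unfolding palindromic_unimodular_def A_def
      using symmetric_extension_reflect[OF n] norm_symmetric_extension[OF a(1)] a(2)
      by (auto simp: symmetric_extension_def[of _ _ _ 0])
    moreover have "Z \<subseteq> disc_zeros n (A l)"
      using Z by (auto simp: disc_zeros_def G_def)
    ultimately show ?thesis
      using \<open>finite Z\<close> by blast
  qed
  then show ?thesis by blast
qed

section \<open>From zeros in the disc to the harmonic polynomial\<close>

lemma unimodular_pair:
  fixes A :: "nat \<Rightarrow> complex"
  assumes A: "\<And>k. norm (A k) = 1" and n: "n \<ge> 1"
  defines "q \<equiv> \<Sum>k<n. monom (cis (pi/3) * A k) k"
  defines "p \<equiv> q + monom 1 n"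
  shows "degree p = n" "degree q = n - 1" "unimodular_coeffs p" "unimodular_coeffs q"
proof -
  have cq: "coeff q k = (if k < n then cis (pi/3) * A k else 0)" for k
    unfolding q_def by (simp add: coeff_sum coeff_monom)
  have cp: "coeff p k = (if k < n then cis (pi/3) * A k else if k = n then 1 else 0)" for k
    unfolding p_def by (simp add: cq coeff_monom)
  have "A k \<noteq> 0" for k
    using A[of k] by auto
  then show dq: "degree q = n - 1"
    using n by (intro antisym degree_le le_degree) (auto simp: cq)
  show dp: "degree p = n"
    by (intro antisym degree_le le_degree) (auto simp: cp)
  show "unimodular_coeffs p" "unimodular_coeffs q"
    using A n by (auto simp: unimodular_coeffs_def dp dq cp cq norm_mult)
qed

text \<open>With \<open>z ^ n = x\<close> real, the harmonic polynomial equals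
  \<open>2 * Re (poly q z) + x\<close>. Since \<open>cos (pi/3) = 1/2\<close>, this is twice the
  real part of \<open>poly q z + cis (pi/3) * x\<close>, the rotated full sum.\<close>

lemma harmonic_zero_on_rays:
  fixes A :: "nat \<Rightarrow> complex"
  assumes "A n = 1" "z ^ n \<in> \<real>" and zero: "Re (cis (pi/3) * (\<Sum>k\<le>n. A k * z ^ k)) = 0"
  defines "q \<equiv> \<Sum>k<n. monom (cis (pi/3) * A k) k"
  shows "poly (q + monom 1 n) z + cnj (poly q z) = 0"
proof -
  obtain x where x: "z ^ n = of_real x"
    using assms(2) by (elim Reals_cases)
  have "cis (pi/3) * (\<Sum>k\<le>n. A k * z ^ k) = poly q z + cis (pi/3) * of_real x"
    by (simp add: q_def poly_sum poly_monom assms(1) x sum_distrib_left distrib_left mult.assoc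
        flip: lessThan_Suc_atMost)
  moreover have "2 * Re (poly q z + cis (pi/3) * of_real x) = 2 * Re (poly q z) + x"
    by (simp add: cos_60)
  ultimately have "2 * Re (poly q z) + x = 0"
    using zero by (simp add: cos_60)
  then show ?thesis
    by (simp add: poly_monom x complex_eq_iff)
qed

text \<open>Self-reciprocity. On the rays the factor \<open>inverse (z ^ n)\<close> is real, so a
  vanishing real part is inherited by \<open>inverse z\<close>.\<close>

lemma palindromic_inverse:
  fixes A :: "nat \<Rightarrow> complex"
  assumes "\<And>k. k \<le> n \<Longrightarrow> A (n - k) = A k" "z \<noteq> 0"
  shows "(\<Sum>k\<le>n. A k * inverse z ^ k) = inverse (z ^ n) * (\<Sum>k\<le>n. A k * z ^ k)"
proof -
  have "(\<Sum>k\<le>n. A k * inverse z ^ k) = (\<Sum>k\<le>n. A (n - k) * inverse z ^ (n - k))"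
    using sum.nat_diff_reindex[of "\<lambda>k. A k * inverse z ^ k" "Suc n"] by (simp add: lessThan_Suc_atMost)
  also have "\<dots> = (\<Sum>k\<le>n. inverse (z ^ n) * (A k * z ^ k))"
  proof (rule sum.cong)
    fix k assume "k \<in> {..n}"
    then have "k \<le> n" by simp
    then have "z ^ n = z ^ (n - k) * z ^ k"
      by (simp flip: power_add)
    then have "inverse z ^ (n - k) = inverse (z ^ n) * z ^ k"
      using assms(2) by (simp add: power_inverse)
    then show "A (n - k) * inverse z ^ (n - k) = inverse (z ^ n) * (A k * z ^ k)"
      using assms(1)[OF \<open>k \<le> n\<close>] by simp
  qed simp
  finally show ?thesis
    by (simp add: sum_distrib_left)
qed

theorem theorem1p7:
  shows "\<exists>C::real. C > 0 \<and>
    (\<forall>n::nat. n \<ge> 2 \<longrightarrow>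
      (\<exists>p q :: complex poly.
         degree p = n \<and> degree q = n - 1 \<and>
         unimodular_coeffs p \<and> unimodular_coeffs q \<and>
         (\<exists>S. finite S \<and> S \<subseteq> {z. poly p z + cnj (poly q z) = 0} \<and>
              real (card S) \<ge> 2 / pi * real n * ln (real n) - C * real n)))"
proof -
  obtain L0 i0 :: nat where zeros: "\<forall>L\<ge>L0. \<forall>n. 2 * 2^L \<le> n \<longrightarrow>
     (\<exists>A Z. palindromic_unimodular n A \<and> finite Z \<and> Z \<subseteq> disc_zeros n A \<and>
        real (card Z) \<ge> 7195/10000 / pi * real n * (39/40 * real L - real i0))"
    using many_zeros_in_disc by (elim exE)
  \<comment> \<open>\<open>3 + 2 * i0\<close> absorbs the additive losses for large
    \<open>L\<close>; \<open>L0\<close> makes the claimed bound nonpositive for small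
    \<open>L\<close>.\<close>
  define C :: real where "C = 3 + 2 * real i0 + real L0"
  show ?thesis
  proof (intro exI[of _ C] conjI allI impI)
    show "C > 0" by (simp add: C_def)
    fix n :: nat
    assume "n \<ge> 2"
    \<comment> \<open>The largest \<open>L\<close> with \<open>2 * 2^L \<le> n\<close>, so the two
      coefficient blocks fit.\<close>
    define L where "L = floor_log n - 1"
    have "floor_log n \<ge> 1"
      using floor_log_le_iff[OF \<open>n \<ge> 2\<close>] floor_log_power[of 1] by simp
    then have Ln: "floor_log n = Suc L"
      by (simp add: L_def)
    have low: "2 * 2^L \<le> n"
      using floor_log_exp2_le[of n] \<open>n \<ge> 2\<close> by (simp add: Ln)
    have "n < 2 ^ (L + 2)"
      using floor_log_exp2_gt[of n] by (simp add: Ln)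
    then have "real n \<le> 2 ^ (L + 2)"
      by (metis less_imp_le of_nat_le_iff of_nat_numeral of_nat_power)
    then have "ln (real n) \<le> ln (2 ^ (L + 2))"
      using \<open>n \<ge> 2\<close> by simp
    also have "\<dots> = (real L + 2) * ln 2"
      by (subst ln_realpow) simp_all
    also have "\<dots> \<le> (real L + 2) * (25/36)"
      using ln2_le_25_over_36 by (intro mult_left_mono) auto
    finally have ln_n: "ln (real n) \<le> (real L + 2) * (25/36)" .
    have pi_ge: "1 / pi \<le> 1/3"
      using pi_gt3 by (simp add: field_simps)
    show "\<exists>p q :: complex poly.
         degree p = n \<and> degree q = n - 1 \<and>
         unimodular_coeffs p \<and> unimodular_coeffs q \<and>
         (\<exists>S. finite S \<and> S \<subseteq> {z. poly p z + cnj (poly q z) = 0} \<and>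
              real (card S) \<ge> 2 / pi * real n * ln (real n) - C * real n)"
    proof (cases "L \<ge> L0")
      case False
      have "2 / pi * ln (real n) \<le> 1 * ((real L + 2) * (25/36))"
        using ln_n pi_gt3 \<open>n \<ge> 2\<close> by (intro mult_mono) auto
      also have "\<dots> \<le> C"
        using False by (simp add: C_def)
      finally have "2 / pi * ln (real n) * real n \<le> C * real n"
        by (rule mult_right_mono) simp
      then have few: "2 / pi * real n * ln (real n) - C * real n \<le> real (card ({}::complex set))"
        by (simp add: mult_ac)
      define q where "q = (\<Sum>k<n. monom (cis (pi/3) * (\<lambda>_::nat. 1) k) k)"
      define p where "p = q + monom 1 n"
      have "degree p = n \<and> degree q = n - 1 \<and> unimodular_coeffs p \<and> unimodular_coeffs q"
        using unimodular_pair[of "\<lambda>_. 1" n] \<open>n \<ge> 2\<close> unfolding p_def q_def by simp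
      then show ?thesis
        using few by (metis empty_subsetI finite.emptyI)
    next
      case True
      then obtain A Z where "palindromic_unimodular n A" "finite Z" "Z \<subseteq> disc_zeros n A"
        and card_Z: "real (card Z) \<ge> 7195/10000 / pi * real n * (39/40 * real L - real i0)"
        using zeros low by blast
      then have A: "\<And>k. norm (A k) = 1" "A 0 = 1" "\<And>k. k \<le> n \<Longrightarrow> A (n - k) = A k"
        and Z: "\<And>z. z \<in> Z \<Longrightarrow> 0 < norm z \<and> norm z < 1 \<and> z ^ n \<in> \<real> \<and>
             Re (cis (pi/3) * (\<Sum>k\<le>n. A k * z ^ k)) = 0"
        unfolding palindromic_unimodular_def disc_zeros_def by blast+
      have An: "A n = 1" using A(2) A(3)[of n] by simp
      define q where "q = (\<Sum>k<n. monom (cis (pi/3) * A k) k)"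
      define p where "p = q + monom 1 n"
      \<comment> \<open>Inversion sends the disc zeros to equally many zeros outside the closed
        disc.\<close>
      define S where "S = Z \<union> inverse ` Z"
      have inside: "poly p z + cnj (poly q z) = 0" if "z \<in> Z" for z
        using harmonic_zero_on_rays[of A n z] An Z[OF that] unfolding p_def q_def by blast
      have outside: "poly p (inverse z) + cnj (poly q (inverse z)) = 0" if zZ: "z \<in> Z" for z
      proof -
        obtain x where x: "z ^ n = of_real x"
          using Z[OF zZ] by (auto elim: Reals_cases)
        have inv: "inverse z ^ n = of_real (inverse x)"
          by (simp add: power_inverse x)
        have "z \<noteq> 0" using Z[OF zZ] by auto
        then have "cis (pi/3) * (\<Sum>k\<le>n. A k * inverse z ^ k) = of_real (inverse x) * (cis (pi/3) * (\<Sum>k\<le>n. A k * z ^ k))"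
          using palindromic_inverse[of n A z] A(3) by (simp add: x)
        moreover have "Re (of_real y * w) = y * Re w" for y w
          by simp
        ultimately have "Re (cis (pi/3) * (\<Sum>k\<le>n. A k * inverse z ^ k)) = 0"
          using Z[OF zZ] by (simp only: mult_zero_right)
        moreover have "inverse z ^ n \<in> \<real>"
          unfolding inv by (rule Reals_of_real)
        ultimately show ?thesis
          using harmonic_zero_on_rays[of A n "inverse z"] An unfolding p_def q_def by blast
      qed
      have "card S = card Z + card (inverse ` Z)"
        unfolding S_def
      proof (rule card_Un_disjoint)
        show "Z \<inter> inverse ` Z = {}"
        proof -
          have "norm (inverse z) > 1" if "z \<in> Z" for z
            using Z[OF that] by (simp add: norm_inverse one_less_inverse)
          then show ?thesis using Z by (force simp: not_less)
        qed
      qed (use \<open>finite Z\<close> in auto)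
      also have "card (inverse ` Z) = card Z"
        by (intro card_image inj_onI) simp
      finally have card_S: "real (card S) = 2 * real (card Z)" by simp
      have "2 / pi * ln (real n) - C \<le> 1 / pi * (2 * (7195/10000) * (39/40 * real L - real i0))"
      proof -
        have "2 / pi * ln (real n) \<le> 2 / pi * ((real L + 2) * (25/36))"
          using ln_n by (intro mult_left_mono) auto
        also have "\<dots> = 1 / pi * ((real L + 2) * (25/18))"
          by (simp add: field_simps)
        \<comment> \<open>The decisive numerical margin: \<open>2 * 0.7195 * 39/40\<close> is about
          1.403 and exceeds 25/18, which is about 1.389 and bounds \<open>2 * ln 2\<close>.\<close>
        also have "\<dots> \<le> 1 / pi * (2 * (7195/10000) * (39/40 * real L - real i0) + (3 + 2 * real i0))"
          by (intro mult_left_mono) (auto simp: field_simps)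
        also have "\<dots> = 1 / pi * (2 * (7195/10000) * (39/40 * real L - real i0)) + 1 / pi * (3 + 2 * real i0)"
          by (rule distrib_left)
        also have "1 / pi * (3 + 2 * real i0) \<le> 1/3 * (3 + 2 * real i0)"
          using pi_ge by (intro mult_right_mono) auto
        also have "1/3 * (3 + 2 * real i0) \<le> C"
          by (simp add: C_def)
        finally show ?thesis by simp
      qed
      then have "(2 / pi * ln (real n) - C) * real n \<le> 1 / pi * (2 * (7195/10000) * (39/40 * real L - real i0)) * real n"
        by (rule mult_right_mono) simp
      also have "\<dots> = 2 * (7195/10000 / pi * real n * (39/40 * real L - real i0))"
        by (simp add: field_simps)
      also have "\<dots> \<le> real (card S)"
        unfolding card_S using card_Z by simp
      finally have "2 / pi * real n * ln (real n) - C * real n \<le> real (card S)"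
        by (simp add: algebra_simps)
      moreover have "S \<subseteq> {z. poly p z + cnj (poly q z) = 0}"
        using inside outside by (auto simp: S_def)
      moreover have "finite S"
        using \<open>finite Z\<close> by (simp add: S_def)
      moreover have "degree p = n \<and> degree q = n - 1 \<and> unimodular_coeffs p \<and> unimodular_coeffs q"
        using unimodular_pair[of A n] A(1) \<open>n \<ge> 2\<close> unfolding p_def q_def by auto
      ultimately show ?thesis by blast
    qed
  qed
qed

end
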